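(* Let $(A_h,\circ_h,\Delta_h)$ be an ASI bialgebra deformation of a commutative and cocommutative ASI bialgebra $(A,\circ,\Delta)$, and let $(A,\{,\},\circ,\delta,\Delta)$ be its quasiclassical limit (QCL). Then $(A,\{,\},\circ,\delta,\Delta)$ is a Poisson bialgebra.
   Context: Conventions. $\mathbf{k}$ is a field of characteristic $0$ and $\mathbf{K}=\mathbf{k}[[h]]$. Vector spaces, algebras and tensor products are over $\mathbf{k}$; algebras need not be unital, coalgebras need not be counital; binary operations are bilinear. For a vector space $V$, $V_h:=V[[h]]$ is the $\mathbf{K}$-module of formal power series with coefficients in $V$; $V\subset V_h$ as constant series; $\equiv \pmod{h^n}$ means equality modulo $h^nV_h$. A topologically free $\mathbf{K}$-module is one isomorphic to some $V[[h]]$. $\hat\otimes$ is the $h$-adic completion of $\otimes_{\mathbf{K}}$, so $V_h\hat\otimes W_h\cong (V\otimes W)[[h]]$. $\sigma(x\otimes y)=y\otimes x$ on $A\otimes A$, and $\sigma_{\mathbf{K}}(x_h\hat\otimes y_h)=y_h\hat\otimes x_h$ on $A_h\hat\otimes A_h$. For an operation $\circ$, $L_\circ(x)y=x\circ y$ and $R_\circ(x)y=y\circ x$ (likewise for $\circ_h$); for a Lie bracket, $\mathrm{ad}_{\{,\}}(x)y=\{x,y\}$. Coassociative coalgebra $(A,\Delta)$: $(\Delta\otimes\mathrm{id})\Delta=(\mathrm{id}\otimes\Delta)\Delta$; cocommutative if $\Delta=\sigma\Delta$. ASI (antisymmetric infinitesimal) bialgebra $(A,\circ,\Delta)$: $(A,\circ)$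 is an associative algebra, $(A,\Delta)$ is a coassociative coalgebra, and for all $x,y\in A$: $\Delta(x\circ y)=(\mathrm{id}\otimes L_\circ(x))\Delta(y)+(R_\circ(y)\otimes\mathrm{id})\Delta(x)$ and $(L_\circ(y)\otimes\mathrm{id}-\mathrm{id}\otimes R_\circ(y))\Delta(x)+\sigma\big((L_\circ(x)\otimes\mathrm{id}-\mathrm{id}\otimes R_\circ(x))\Delta(y)\big)=0$. It is commutative and cocommutative if $\circ$ is commutative and $\Delta$ is cocommutative. Topologically free associative algebra: a topologically free $\mathbf{K}$-module with an associative $\mathbf{K}$-bilinear operation. Topologically free coassociative coalgebra $(A_h,\Delta_h)$: $\Delta_h:A_h\to A_h\hat\otimes A_h$ is $\mathbf{K}$-linear with $(\Delta_h\hat\otimes\mathrm{id})\Delta_h=(\mathrm{id}\hat\otimes\Delta_h)\Delta_h$. Topologically free ASI bialgebra $(A_h,\circ_h,\Delta_h)$: both of these together with, for all $x_h,y_h\in A_h$, $\Delta_h(x_h\circ_h y_h)=(\mathrm{id}\hat\otimes L_{\circ_h}(x_h))\Delta_h(y_h)+(R_{\circ_h}(y_h)\hat\otimes\mathrm{id})\Delta_h(x_h)$ and $(L_{\circ_h}(y_h)\hat\otimes\mathrm{id}-\mathrm{id}\hat\otimes R_{\circ_h}(y_h))\Delta_h(x_h)+\sigma_{\mathbf{K}}\big((L_{\circ_h}(x_h)\hat\otimes\mathrm{id}-\mathrm{id}\hat\otimes R_{\circ_h}(x_h))\Delta_h(y_h)\big)=0$. ASI bialgebra deformation of $(A,\circ,\Delta)$: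 a topologically free ASI bialgebra $(A_h,\circ_h,\Delta_h)$ with $A_h=A[[h]]$, $x\circ_h y\equiv x\circ y\pmod h$ and $\Delta_h(x)\equiv\Delta(x)\pmod h$ for all $x,y\in A$. If $(A,\circ,\Delta)$ is commutative and cocommutative, its QCL is the quintuple $(A,\{,\},\circ,\delta,\Delta)$, where $\{,\}:A\times A\to A$ and $\delta:A\to A\otimes A$ are determined by $\{x,y\}\equiv \frac{x\circ_h y-y\circ_h x}{h}\pmod h$ and $\delta(x)\equiv\frac{\Delta_h(x)-\sigma_{\mathbf{K}}(\Delta_h(x))}{h}\pmod h$ for $x,y\in A$. Poisson algebra $(A,\{,\},\circ)$: $\{,\}$ is a Lie bracket, $\circ$ is commutative associative, and $\{x,y\circ z\}=\{x,y\}\circ z+y\circ\{x,z\}$. Lie coalgebra $(A,\delta)$: $\delta=-\sigma\delta$ and $(\mathrm{id}+\tau+\tau^2)(\mathrm{id}\otimes\delta)\delta=0$, where $\tau(x\otimes y\otimes z)=z\otimes x\otimes y$. Lie bialgebra $(A,\{,\},\delta)$: a Lie algebra and a Lie coalgebra with $\delta(\{x,y\})=(\mathrm{ad}(x)\otimes\mathrm{id}+\mathrm{id}\otimes\mathrm{ad}(x))\delta(y)-(\mathrm{ad}(y)\otimes\mathrm{id}+\mathrm{id}\otimes\mathrm{ad}(y))\delta(x)$, $\mathrm{ad}=\mathrm{ad}_{\{,\}}$. Poisson coalgebra $(A,\delta,\Delta)$: $(A,\delta)$ is a Lie coalgebra, $(A,\Delta)$ is a cocommutative coassociative coalgebra,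 and $(\mathrm{id}\otimes\Delta)\delta=(\delta\otimes\mathrm{id})\Delta+(\sigma\otimes\mathrm{id})(\mathrm{id}\otimes\delta)\Delta$. Poisson bialgebra $(A,\{,\},\circ,\delta,\Delta)$: $(A,\{,\},\circ)$ is a Poisson algebra, $(A,\{,\},\delta)$ a Lie bialgebra, $(A,\delta,\Delta)$ a Poisson coalgebra, $(A,\circ,\Delta)$ a commutative and cocommutative ASI bialgebra, and for all $x,y\in A$: $\delta(x\circ y)=(L_\circ(y)\otimes\mathrm{id})\delta(x)+(L_\circ(x)\otimes\mathrm{id})\delta(y)+(\mathrm{id}\otimes\mathrm{ad}(x))\Delta(y)+(\mathrm{id}\otimes\mathrm{ad}(y))\Delta(x)$, $\Delta(\{x,y\})=(\mathrm{ad}(x)\otimes\mathrm{id}+\mathrm{id}\otimes\mathrm{ad}(x))\Delta(y)+(L_\circ(y)\otimes\mathrm{id}-\mathrm{id}\otimes L_\circ(y))\delta(x)$. *)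

theory Defs
  imports
    "HOL-Library.Function_Algebras"
    "HOL-Computational_Algebra.Formal_Power_Series"
begin

section \<open>Tensor powers of a vector space\<close>

text \<open>
  Vector spaces over a field \<open>'k\<close> are given by their scalar multiplication \<open>s\<close>, as in the library
  locale \<^locale>\<open>vector_space\<close>.  The relation identifying \<open>c x \<otimes> y\<close> with \<open>x \<otimes> c y\<close> depends on \<open>s\<close>, so
  the tensor product is a subspace of a function type, not a type of its own: the pure tensor
  \<open>x \<otimes> y\<close> is the evaluation \<open>\<phi> \<mapsto> \<phi> x y\<close> on bilinear forms (extended by \<open>0\<close> to all other \<open>\<phi>\<close>), and the
  tensor product is the linear span of the pure tensors.  The theorems \<open>tensor2_universal\<close> and
  \<open>tensor3_universal\<close> below are the usual universal properties.
\<close>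

definition bilinear_map ::
  "('r::comm_ring_1 \<Rightarrow> 'a::ab_group_add \<Rightarrow> 'a) \<Rightarrow> ('r \<Rightarrow> 'b::ab_group_add \<Rightarrow> 'b) \<Rightarrow> ('a \<Rightarrow> 'a \<Rightarrow> 'b) \<Rightarrow> bool"
  where "bilinear_map s t f \<longleftrightarrow>
    (\<forall>x. module_hom s t (\<lambda>y. f x y)) \<and> (\<forall>y. module_hom s t (\<lambda>x. f x y))"

definition trilinear_map ::
  "('r::comm_ring_1 \<Rightarrow> 'a::ab_group_add \<Rightarrow> 'a) \<Rightarrow> ('r \<Rightarrow> 'b::ab_group_add \<Rightarrow> 'b) \<Rightarrow>
   ('a \<Rightarrow> 'a \<Rightarrow> 'a \<Rightarrow> 'b) \<Rightarrow> bool"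
  where "trilinear_map s t f \<longleftrightarrow>
    (\<forall>x y. module_hom s t (\<lambda>z. f x y z)) \<and> (\<forall>x z. module_hom s t (\<lambda>y. f x y z)) \<and>
    (\<forall>y z. module_hom s t (\<lambda>x. f x y z))"

type_synonym ('k, 'a) functional2 = "('a \<Rightarrow> 'a \<Rightarrow> 'k) \<Rightarrow> 'k"
type_synonym ('k, 'a) functional3 = "('a \<Rightarrow> 'a \<Rightarrow> 'a \<Rightarrow> 'k) \<Rightarrow> 'k"

definition fun_scale :: "'k::field \<Rightarrow> ('p \<Rightarrow> 'k) \<Rightarrow> 'p \<Rightarrow> 'k"
  where "fun_scale c F = (\<lambda>p. c * F p)"

definition tensor2 :: "('k::field \<Rightarrow> 'a::ab_group_add \<Rightarrow> 'a) \<Rightarrow> 'a \<Rightarrow> 'a \<Rightarrow> ('k, 'a) functional2"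
  where "tensor2 s x y = (\<lambda>\<phi>. if bilinear_map s (*) \<phi> then \<phi> x y else 0)"

definition tensor3 :: "('k::field \<Rightarrow> 'a::ab_group_add \<Rightarrow> 'a) \<Rightarrow> 'a \<Rightarrow> 'a \<Rightarrow> 'a \<Rightarrow> ('k, 'a) functional3"
  where "tensor3 s x y z = (\<lambda>\<psi>. if trilinear_map s (*) \<psi> then \<psi> x y z else 0)"

definition tensor2_space :: "('k::field \<Rightarrow> 'a::ab_group_add \<Rightarrow> 'a) \<Rightarrow> ('k, 'a) functional2 set"
  where "tensor2_space s = module.span fun_scale {tensor2 s x y | x y. True}"

definition tensor3_space :: "('k::field \<Rightarrow> 'a::ab_group_add \<Rightarrow> 'a) \<Rightarrow> ('k, 'a) functional3 set"
  where "tensor3_space s = module.span fun_scale {tensor3 s x y z | x y z. True}"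

subsection \<open>Universal properties\<close>

lemma vector_space_fun_scale: "vector_space (fun_scale :: 'k::field \<Rightarrow> ('p \<Rightarrow> 'k) \<Rightarrow> 'p \<Rightarrow> 'k)"
  by unfold_locales (auto simp: fun_scale_def fun_eq_iff algebra_simps)

lemma vector_space_times: "vector_space ((*) :: 'k::field \<Rightarrow> 'k \<Rightarrow> 'k)"
  by unfold_locales (auto simp: algebra_simps)

lemma exists_separating_functional:
  fixes t :: "'k::field \<Rightarrow> 'w::ab_group_add \<Rightarrow> 'w"
  assumes "vector_space t" "w \<noteq> 0"
  shows "\<exists>l. Vector_Spaces.linear t (*) l \<and> l w \<noteq> 0"
proof -
  interpret W: vector_space t by fact
  interpret K: vector_space "(*) :: 'k \<Rightarrow> 'k \<Rightarrow> 'k" by (rule vector_space_times)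
  interpret P: vector_space_pair t "(*) :: 'k \<Rightarrow> 'k \<Rightarrow> 'k" ..
  have "W.independent {w}" using assms(2) by simp
  from P.linear_independent_extend[OF this, of "\<lambda>_. 1"] show ?thesis by auto
qed

lemma functional_extension:
  fixes E :: "'i \<Rightarrow> 'p \<Rightarrow> 'k::field" and t :: "'k \<Rightarrow> 'w::ab_group_add \<Rightarrow> 'w"
  assumes t: "vector_space t"
    and sep: "\<And>l. Vector_Spaces.linear t (*) l \<Longrightarrow> \<exists>p. \<forall>i. l (f i) = E i p"
  shows "\<exists>g. Vector_Spaces.linear fun_scale t g \<and> (\<forall>i. g (E i) = f i)"
proof -
  interpret W: vector_space t by fact
  interpret F: vector_space "fun_scale :: 'k \<Rightarrow> ('p \<Rightarrow> 'k) \<Rightarrow> 'p \<Rightarrow> 'k"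
    by (rule vector_space_fun_scale)
  interpret P: vector_space_pair "fun_scale :: 'k \<Rightarrow> ('p \<Rightarrow> 'k) \<Rightarrow> 'p \<Rightarrow> 'k" t ..
  obtain B where B: "B \<subseteq> range E" "F.independent B" "range E \<subseteq> F.span B"
    using F.maximal_independent_subset[of "range E"] by blast
  define r where "r b = (SOME i. E i = b)" for b
  have r: "E (r b) = b" if "b \<in> B" for b
    unfolding r_def by (rule someI_ex) (use that B(1) in auto)
  obtain g where g: "Vector_Spaces.linear fun_scale t g" "\<forall>b\<in>B. g b = f (r b)"
    using P.linear_independent_extend[OF B(2), of "\<lambda>b. f (r b)"] by auto
  interpret g: Vector_Spaces.linear fun_scale t g by fact
  have "g (E i) = f i" for i
  proof (rule ccontr)
    assume "g (E i) \<noteq> f i"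
    then obtain l where l: "Vector_Spaces.linear t (*) l" "l (g (E i) - f i) \<noteq> 0"
      using exists_separating_functional[OF t, of "g (E i) - f i"] by auto
    interpret l: Vector_Spaces.linear t "(*)" l by fact
    obtain p where p: "\<And>j. l (f j) = E j p" using sep[OF l(1)] by blast
    have "l (g b) = b p" if "b \<in> F.span B" for b
      using that
    proof (induction rule: F.span_induct_alt)
      case base
      then show ?case by (metis g.zero l.zero zero_fun_apply)
    next
      case (step c x y)
      have x: "l (g x) = x p" using g(2) step(1) p r by auto
      have "l (g (fun_scale c x + y)) = c * l (g x) + l (g y)"
        by (simp only: g.add g.scale l.add l.scale)
      then show ?case using step(2) x by (simp add: fun_scale_def plus_fun_def)
    qed
    then have "l (g (E i)) = E i p" using B(3) by auto
    then show False using l(2) p by (simp add: l.diff)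
  qed
  then show ?thesis using g(1) by blast
qed

lemma module_hom_comp:
  "module_hom s t f \<Longrightarrow> module_hom t u g \<Longrightarrow> module_hom s u (\<lambda>x. g (f x))"
  unfolding module_hom_def module_hom_axioms_def by simp

lemma linear_module_hom: "Vector_Spaces.linear s t f \<Longrightarrow> module_hom s t f"
  by (simp add: linear_iff_module_hom)

theorem tensor2_universal:
  fixes t :: "'k::field \<Rightarrow> 'w::ab_group_add \<Rightarrow> 'w"
  assumes s: "vector_space s" and t: "vector_space t"
  shows "bilinear_map s fun_scale (tensor2 s)"
    and "bilinear_map s t f \<Longrightarrow>
      \<exists>g. Vector_Spaces.linear fun_scale t g \<and> (\<forall>x y. g (tensor2 s x y) = f x y)"
    and "\<lbrakk>Vector_Spaces.linear fun_scale t g; Vector_Spaces.linear fun_scale t g';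
      \<And>x y. g (tensor2 s x y) = g' (tensor2 s x y); F \<in> tensor2_space s\<rbrakk> \<Longrightarrow> g F = g' F"
proof -
  have ms: "module s" using s by (simp add: module_iff_vector_space)
  have mf: "module (fun_scale :: 'k \<Rightarrow> ('p \<Rightarrow> 'k) \<Rightarrow> 'p \<Rightarrow> 'k)"
    using vector_space_fun_scale by (simp add: module_iff_vector_space)
  show "bilinear_map s fun_scale (tensor2 s)"
    using ms mf
    by (auto simp: bilinear_map_def module_hom_def module_hom_axioms_def tensor2_def
        fun_scale_def fun_eq_iff)
next
  assume f: "bilinear_map s t f"
  have "\<exists>p. \<forall>i. l (case_prod f i) = (case i of (x, y) \<Rightarrow> tensor2 s x y) p"
    if l: "Vector_Spaces.linear t (*) l" for l
  proof -
    have "bilinear_map s (*) (\<lambda>x y. l (f x y))"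
      using f by (auto simp: bilinear_map_def intro: module_hom_comp[OF _ linear_module_hom[OF l]])
    then show ?thesis
      by (intro exI[of _ "\<lambda>x y. l (f x y)"]) (auto simp: tensor2_def)
  qed
  from functional_extension[OF t, of "case_prod f", OF this]
  show "\<exists>g. Vector_Spaces.linear fun_scale t g \<and> (\<forall>x y. g (tensor2 s x y) = f x y)"
    by auto
next
  assume g: "Vector_Spaces.linear fun_scale t g" and g': "Vector_Spaces.linear fun_scale t g'"
    and eq: "\<And>x y. g (tensor2 s x y) = g' (tensor2 s x y)" and F: "F \<in> tensor2_space s"
  interpret P: vector_space_pair "fun_scale :: 'k \<Rightarrow> ('p \<Rightarrow> 'k) \<Rightarrow> 'p \<Rightarrow> 'k" t
    using vector_space_fun_scale t by (rule vector_space_pair.intro)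
  show "g F = g' F"
    by (rule P.linear_eq_on_span[OF g g' _ F[unfolded tensor2_space_def]]) (auto simp: eq)
qed

theorem tensor3_universal:
  fixes t :: "'k::field \<Rightarrow> 'w::ab_group_add \<Rightarrow> 'w"
  assumes s: "vector_space s" and t: "vector_space t"
  shows "trilinear_map s fun_scale (tensor3 s)"
    and "trilinear_map s t f \<Longrightarrow>
      \<exists>g. Vector_Spaces.linear fun_scale t g \<and> (\<forall>x y z. g (tensor3 s x y z) = f x y z)"
    and "\<lbrakk>Vector_Spaces.linear fun_scale t g; Vector_Spaces.linear fun_scale t g';
      \<And>x y z. g (tensor3 s x y z) = g' (tensor3 s x y z); F \<in> tensor3_space s\<rbrakk> \<Longrightarrow> g F = g' F"
proof -
  have ms: "module s" using s by (simp add: module_iff_vector_space)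
  have mf: "module (fun_scale :: 'k \<Rightarrow> ('p \<Rightarrow> 'k) \<Rightarrow> 'p \<Rightarrow> 'k)"
    using vector_space_fun_scale by (simp add: module_iff_vector_space)
  show "trilinear_map s fun_scale (tensor3 s)"
    using ms mf
    by (auto simp: trilinear_map_def module_hom_def module_hom_axioms_def tensor3_def
        fun_scale_def fun_eq_iff)
next
  assume f: "trilinear_map s t f"
  have "\<exists>p. \<forall>i. l (case i of (x, y, z) \<Rightarrow> f x y z) = (case i of (x, y, z) \<Rightarrow> tensor3 s x y z) p"
    if l: "Vector_Spaces.linear t (*) l" for l
  proof -
    have "trilinear_map s (*) (\<lambda>x y z. l (f x y z))"
      using f by (auto simp: trilinear_map_def intro: module_hom_comp[OF _ linear_module_hom[OF l]])
    then show ?thesis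
      by (intro exI[of _ "\<lambda>x y z. l (f x y z)"]) (auto simp: tensor3_def)
  qed
  from functional_extension[OF t, of "\<lambda>i. case i of (x, y, z) \<Rightarrow> f x y z", OF this]
  show "\<exists>g. Vector_Spaces.linear fun_scale t g \<and> (\<forall>x y z. g (tensor3 s x y z) = f x y z)"
    by auto
next
  assume g: "Vector_Spaces.linear fun_scale t g" and g': "Vector_Spaces.linear fun_scale t g'"
    and eq: "\<And>x y z. g (tensor3 s x y z) = g' (tensor3 s x y z)" and F: "F \<in> tensor3_space s"
  interpret P: vector_space_pair "fun_scale :: 'k \<Rightarrow> ('p \<Rightarrow> 'k) \<Rightarrow> 'p \<Rightarrow> 'k" t
    using vector_space_fun_scale t by (rule vector_space_pair.intro)
  show "g F = g' F"
    by (rule P.linear_eq_on_span[OF g g' _ F[unfolded tensor3_space_def]]) (auto simp: eq)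
qed

subsection \<open>Maps between tensor powers\<close>

text \<open>
  \<open>tmap s f g\<close> is \<open>f \<otimes> g\<close>, \<open>tmap_left s D\<close> is \<open>D \<otimes> id\<close> and \<open>tmap_right s D\<close> is \<open>id \<otimes> D\<close> for
  \<open>D : A \<rightarrow> A \<otimes> A\<close>.
\<close>

definition tmap :: "('k::field \<Rightarrow> 'a::ab_group_add \<Rightarrow> 'a) \<Rightarrow> ('a \<Rightarrow> 'a) \<Rightarrow> ('a \<Rightarrow> 'a) \<Rightarrow>
    ('k, 'a) functional2 \<Rightarrow> ('k, 'a) functional2"
  where "tmap s f g F =
    (\<lambda>\<phi>. if bilinear_map s (*) \<phi> then F (\<lambda>x y. \<phi> (f x) (g y)) else 0)"

definition tmap_left :: "('k::field \<Rightarrow> 'a::ab_group_add \<Rightarrow> 'a) \<Rightarrow> ('a \<Rightarrow> ('k, 'a) functional2) \<Rightarrow>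
    ('k, 'a) functional2 \<Rightarrow> ('k, 'a) functional3"
  where "tmap_left s D F =
    (\<lambda>\<psi>. if trilinear_map s (*) \<psi> then F (\<lambda>x y. D x (\<lambda>u v. \<psi> u v y)) else 0)"

definition tmap_right :: "('k::field \<Rightarrow> 'a::ab_group_add \<Rightarrow> 'a) \<Rightarrow> ('a \<Rightarrow> ('k, 'a) functional2) \<Rightarrow>
    ('k, 'a) functional2 \<Rightarrow> ('k, 'a) functional3"
  where "tmap_right s D F =
    (\<lambda>\<psi>. if trilinear_map s (*) \<psi> then F (\<lambda>x y. D y (\<lambda>u v. \<psi> x u v)) else 0)"

text \<open>\<open>flip\<close> is \<open>\<sigma>\<close>, \<open>flip_left\<close> is \<open>\<sigma> \<otimes> id\<close> and \<open>rotate3\<close> is \<open>\<tau>\<close>.\<close>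

definition flip :: "('k, 'a) functional2 \<Rightarrow> ('k, 'a) functional2"
  where "flip F = (\<lambda>\<phi>. F (\<lambda>x y. \<phi> y x))"

definition flip_left :: "('k, 'a) functional3 \<Rightarrow> ('k, 'a) functional3"
  where "flip_left F = (\<lambda>\<psi>. F (\<lambda>x y z. \<psi> y x z))"

definition rotate3 :: "('k, 'a) functional3 \<Rightarrow> ('k, 'a) functional3"
  where "rotate3 F = (\<lambda>\<psi>. F (\<lambda>x y z. \<psi> z x y))"

lemma fun_scale_linearI:
  assumes "\<And>F G p. T (\<lambda>q. F q + G q) p = T F p + T G p" "\<And>c F p. T (\<lambda>q. c * F q) p = c * T F p"
  shows "Vector_Spaces.linear fun_scale fun_scale T"
proof -
  have "T (F + G) = T F + T G" "T (fun_scale c F) = fun_scale c (T F)" for F G c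
    using assms by (auto simp: fun_eq_iff plus_fun_def fun_scale_def)
  then show ?thesis
    by (auto simp: vector_space_fun_scale linear_iff_module_hom module_hom_def module_hom_axioms_def
        module_iff_vector_space)
qed

lemma linear_tensor_maps:
  shows "Vector_Spaces.linear fun_scale fun_scale (tmap s f g)"
    and "Vector_Spaces.linear fun_scale fun_scale (tmap_left s D)"
    and "Vector_Spaces.linear fun_scale fun_scale (tmap_right s D)"
    and "Vector_Spaces.linear fun_scale fun_scale (flip :: ('k::field, 'a) functional2 \<Rightarrow> _)"
    and "Vector_Spaces.linear fun_scale fun_scale (flip_left :: ('k::field, 'a) functional3 \<Rightarrow> _)"
    and "Vector_Spaces.linear fun_scale fun_scale (rotate3 :: ('k::field, 'a) functional3 \<Rightarrow> _)"
  by (rule fun_scale_linearI;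
      simp add: tmap_def tmap_left_def tmap_right_def flip_def flip_left_def rotate3_def)+

lemma tmap_tensor2:
  assumes "module_hom s s f" "module_hom s s g"
  shows "tmap s f g (tensor2 s x y) = tensor2 s (f x) (g y)"
proof -
  have "bilinear_map s (*) (\<lambda>x y. \<phi> (f x) (g y))" if "bilinear_map s (*) \<phi>" for \<phi>
    unfolding bilinear_map_def
  proof (intro conjI allI)
    show "module_hom s (*) (\<lambda>y. \<phi> (f x) (g y))" for x
      using that by (intro module_hom_comp[OF assms(2)]) (simp add: bilinear_map_def)
    show "module_hom s (*) (\<lambda>x. \<phi> (f x) (g y))" for y
      using that
      by (intro module_hom_comp[OF assms(1), where g = "\<lambda>x. \<phi> x (g y)"]) (simp add: bilinear_map_def)
  qed
  then show ?thesis by (auto simp: tmap_def tensor2_def fun_eq_iff)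
qed

lemma flip_tensors:
  shows "flip (tensor2 s x y) = tensor2 s y x"
    and "flip_left (tensor3 s x y z) = tensor3 s y x z"
    and "rotate3 (tensor3 s x y z) = tensor3 s z x y"
  by (auto simp: flip_def flip_left_def rotate3_def tensor2_def tensor3_def fun_eq_iff
      bilinear_map_def trilinear_map_def)

lemma module_hom_span_eval:
  assumes s: "vector_space s" and \<psi>: "\<And>u v. module_hom s (*) (\<lambda>z. \<psi> u v z)"
    and b: "\<And>z. bilinear_map s (*) (\<lambda>u v. \<psi> u v z)" and F: "F \<in> tensor2_space s"
  shows "module_hom s (*) (\<lambda>z. F (\<lambda>u v. \<psi> u v z))"
proof -
  interpret F: vector_space "fun_scale :: 'k::field \<Rightarrow> ('p \<Rightarrow> 'k) \<Rightarrow> 'p \<Rightarrow> 'k"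
    by (rule vector_space_fun_scale)
  have ms: "module s" "module ((*) :: 'a \<Rightarrow> 'a \<Rightarrow> 'a)"
    using s vector_space_times by (simp_all add: module_iff_vector_space)
  from F[unfolded tensor2_space_def] show ?thesis
  proof (induction rule: F.span_induct_alt)
    case base
    then show ?case using ms by (auto simp: module_hom_def module_hom_axioms_def)
  next
    case (step c x y)
    then obtain a b' where x: "x = tensor2 s a b'" by auto
    have "module_hom s (*) (\<lambda>z. x (\<lambda>u v. \<psi> u v z))"
      unfolding x tensor2_def using b \<psi> by simp
    with step(2) show ?case
      by (auto simp: module_hom_def module_hom_axioms_def fun_scale_def algebra_simps)
  qed
qed

lemma sum_fun_app: "(\<Sum>i\<in>I. f i) p = (\<Sum>i\<in>I. f i p)"
  by (induction I rule: infinite_finite_induct) auto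

lemma tmap_left_right_tensor2:
  assumes s: "vector_space s" and D: "module_hom s fun_scale D" and R: "\<And>x. D x \<in> tensor2_space s"
  shows "D x = (\<Sum>i\<in>I. tensor2 s (u i) (v i)) \<Longrightarrow>
      tmap_left s D (tensor2 s x y) = (\<Sum>i\<in>I. tensor3 s (u i) (v i) y)"
    and "D y = (\<Sum>i\<in>I. tensor2 s (u i) (v i)) \<Longrightarrow>
      tmap_right s D (tensor2 s x y) = (\<Sum>i\<in>I. tensor3 s x (u i) (v i))"
proof -
  have ms: "module s" "module ((*) :: 'a \<Rightarrow> 'a \<Rightarrow> 'a)"
    using s vector_space_times by (simp_all add: module_iff_vector_space)
  have D': "module_hom s (*) (\<lambda>x. D x \<phi>)" for \<phi>
    using D ms by (auto simp: module_hom_def module_hom_axioms_def fun_scale_def)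
  have b: "bilinear_map s (*) (\<lambda>x y. D x (\<lambda>u v. \<psi> u v y))"
    "bilinear_map s (*) (\<lambda>x y. D y (\<lambda>u v. \<psi> x u v))" if \<psi>: "trilinear_map s (*) \<psi>" for \<psi>
  proof -
    have "module_hom s (*) (\<lambda>y. D x (\<lambda>u v. \<psi> u v y))" for x
      by (rule module_hom_span_eval[OF s _ _ R])
        (use \<psi> in \<open>simp_all add: trilinear_map_def bilinear_map_def\<close>)
    moreover have "module_hom s (*) (\<lambda>x. D y (\<lambda>u v. \<psi> x u v))" for y
      by (rule module_hom_span_eval[OF s _ _ R, where \<psi> = "\<lambda>u v x. \<psi> x u v"])
        (use \<psi> in \<open>simp_all add: trilinear_map_def bilinear_map_def\<close>)
    ultimately show "bilinear_map s (*) (\<lambda>x y. D x (\<lambda>u v. \<psi> u v y))"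
      "bilinear_map s (*) (\<lambda>x y. D y (\<lambda>u v. \<psi> x u v))"
      unfolding bilinear_map_def using D' by blast+
  qed
  have c: "bilinear_map s (*) (\<lambda>u v. \<psi> u v y)" "bilinear_map s (*) (\<lambda>u v. \<psi> x u v)"
    if "trilinear_map s (*) \<psi>" for \<psi> x y
    using that by (auto simp: trilinear_map_def bilinear_map_def)
  show "D x = (\<Sum>i\<in>I. tensor2 s (u i) (v i)) \<Longrightarrow>
      tmap_left s D (tensor2 s x y) = (\<Sum>i\<in>I. tensor3 s (u i) (v i) y)"
    using b c by (auto simp: tmap_left_def tensor2_def tensor3_def fun_eq_iff sum_fun_app)
  show "D y = (\<Sum>i\<in>I. tensor2 s (u i) (v i)) \<Longrightarrow>
      tmap_right s D (tensor2 s x y) = (\<Sum>i\<in>I. tensor3 s x (u i) (v i))"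
    using b c by (auto simp: tmap_right_def tensor2_def tensor3_def fun_eq_iff sum_fun_app)
qed


section \<open>ASI bialgebras and Poisson bialgebras\<close>

locale assoc_algebra = vector_space s
  for s :: "'k::field_char_0 \<Rightarrow> 'a::ab_group_add \<Rightarrow> 'a" +
  fixes mul :: "'a \<Rightarrow> 'a \<Rightarrow> 'a"
  assumes mul_bilinear: "bilinear_map s s mul"
    and mul_assoc: "mul (mul x y) z = mul x (mul y z)"

locale coassoc_coalgebra = vector_space s
  for s :: "'k::field_char_0 \<Rightarrow> 'a::ab_group_add \<Rightarrow> 'a" +
  fixes Delta :: "'a \<Rightarrow> ('k, 'a) functional2"
  assumes Delta_linear: "Vector_Spaces.linear s fun_scale Delta"
    and Delta_space: "Delta x \<in> tensor2_space s"
    and coassoc: "tmap_left s Delta (Delta x) = tmap_right s Delta (Delta x)"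

text \<open>Left and right multiplications \<open>L(x)\<close> and \<open>R(x)\<close>; \<open>Lm br x\<close> is \<open>ad(x)\<close> for a Lie bracket.\<close>

definition Lm :: "('a \<Rightarrow> 'a \<Rightarrow> 'a) \<Rightarrow> 'a \<Rightarrow> 'a \<Rightarrow> 'a" where "Lm mul x = (\<lambda>y. mul x y)"
definition Rm :: "('a \<Rightarrow> 'a \<Rightarrow> 'a) \<Rightarrow> 'a \<Rightarrow> 'a \<Rightarrow> 'a" where "Rm mul x = (\<lambda>y. mul y x)"

locale asi_bialgebra = assoc_algebra s mul + coassoc_coalgebra s Delta
  for s :: "'k::field_char_0 \<Rightarrow> 'a::ab_group_add \<Rightarrow> 'a" and mul Delta +
  assumes Delta_mul: "Delta (mul x y) =
      tmap s id (Lm mul x) (Delta y) + tmap s (Rm mul y) id (Delta x)"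
    and antisymmetry:
      "(tmap s (Lm mul y) id (Delta x) - tmap s id (Rm mul y) (Delta x))
       + flip (tmap s (Lm mul x) id (Delta y) - tmap s id (Rm mul x) (Delta y)) = 0"

locale comm_cocomm_asi_bialgebra = asi_bialgebra s mul Delta
  for s :: "'k::field_char_0 \<Rightarrow> 'a::ab_group_add \<Rightarrow> 'a" and mul Delta +
  assumes mul_commute: "mul x y = mul y x"
    and cocommute: "Delta x = flip (Delta x)"

locale lie_algebra = vector_space s
  for s :: "'k::field_char_0 \<Rightarrow> 'a::ab_group_add \<Rightarrow> 'a" +
  fixes br :: "'a \<Rightarrow> 'a \<Rightarrow> 'a"
  assumes br_bilinear: "bilinear_map s s br"
    and br_alternating: "br x x = 0"
    and jacobi: "br x (br y z) + br y (br z x) + br z (br x y) = 0"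

locale poisson_algebra = lie_algebra s br + assoc_algebra s mul
  for s :: "'k::field_char_0 \<Rightarrow> 'a::ab_group_add \<Rightarrow> 'a" and br mul +
  assumes poisson_mul_commute: "mul x y = mul y x"
    and leibniz: "br x (mul y z) = mul (br x y) z + mul y (br x z)"

locale lie_coalgebra = vector_space s
  for s :: "'k::field_char_0 \<Rightarrow> 'a::ab_group_add \<Rightarrow> 'a" +
  fixes delta :: "'a \<Rightarrow> ('k, 'a) functional2"
  assumes delta_linear: "Vector_Spaces.linear s fun_scale delta"
    and delta_space: "delta x \<in> tensor2_space s"
    and delta_skew: "delta x = - flip (delta x)"
    and co_jacobi: "tmap_right s delta (delta x) + rotate3 (tmap_right s delta (delta x))
      + rotate3 (rotate3 (tmap_right s delta (delta x))) = 0"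

locale lie_bialgebra = lie_algebra s br + lie_coalgebra s delta
  for s :: "'k::field_char_0 \<Rightarrow> 'a::ab_group_add \<Rightarrow> 'a" and br delta +
  assumes delta_br: "delta (br x y) =
      (tmap s (Lm br x) id (delta y) + tmap s id (Lm br x) (delta y))
      - (tmap s (Lm br y) id (delta x) + tmap s id (Lm br y) (delta x))"

locale poisson_coalgebra = lie_coalgebra s delta + coassoc_coalgebra s Delta
  for s :: "'k::field_char_0 \<Rightarrow> 'a::ab_group_add \<Rightarrow> 'a" and delta Delta +
  assumes poisson_cocommute: "Delta x = flip (Delta x)"
    and co_leibniz: "tmap_right s Delta (delta x) =
      tmap_left s delta (Delta x) + flip_left (tmap_right s delta (Delta x))"

locale poisson_bialgebra =
  poisson_algebra s br mul + lie_bialgebra s br delta + poisson_coalgebra s delta Delta +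
  comm_cocomm_asi_bialgebra s mul Delta
  for s :: "'k::field_char_0 \<Rightarrow> 'a::ab_group_add \<Rightarrow> 'a" and br mul delta Delta +
  assumes delta_mul: "delta (mul x y) =
      tmap s (Lm mul y) id (delta x) + tmap s (Lm mul x) id (delta y)
      + tmap s id (Lm br x) (Delta y) + tmap s id (Lm br y) (Delta x)"
    and Delta_br: "Delta (br x y) =
      (tmap s (Lm br x) id (Delta y) + tmap s id (Lm br x) (Delta y))
      + (tmap s (Lm mul y) id (delta x) - tmap s id (Lm mul y) (delta x))"

section \<open>Modules of formal power series over \<open>k[[h]]\<close>\<close>

text \<open>
  \<open>V[[h]]\<close> is the type \<open>'v fps\<close>, with \<open>h\<close> rendered as \<^const>\<open>fps_X\<close> and the constant series as
  \<^const>\<open>fps_const\<close>.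
\<close>

definition fps_scale ::
  "('k::field \<Rightarrow> 'v::ab_group_add \<Rightarrow> 'v) \<Rightarrow> 'k fps \<Rightarrow> 'v fps \<Rightarrow> 'v fps"
  where "fps_scale s c f = Abs_fps (\<lambda>n. \<Sum>i\<le>n. s (fps_nth c i) (fps_nth f (n - i)))"

text \<open>Congruence modulo \<open>h\<^sup>n V[[h]]\<close>.\<close>

definition hcong :: "('k::field \<Rightarrow> 'v::ab_group_add \<Rightarrow> 'v) \<Rightarrow> nat \<Rightarrow> 'v fps \<Rightarrow> 'v fps \<Rightarrow> bool"
  where "hcong s n f g \<longleftrightarrow> (\<exists>q. f - g = fps_scale s (fps_X ^ n) q)"

text \<open>
  The completed tensor square of \<open>A[[h]]\<close> is \<open>(A \<otimes> A)[[h]]\<close>, that is, the power series all of whose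
  coefficients lie in \<open>A \<otimes> A\<close>.  A \<open>k[[h]]\<close>-linear map \<open>f\<close> on \<open>V[[h]]\<close> is determined by the coefficient
  maps \<open>f\<^sub>i : V \<rightarrow> W\<close> of its restriction to \<open>V\<close> (see \<open>fps_linear_eq_extend\<close>), and the completed tensor
  products of such maps are obtained by extending \<open>\<Sum>h\<^sup>n \<Sum>(f\<^sub>i \<otimes> g\<^sub>j | i + j = n)\<close>.
\<close>

definition htensor2_space ::
  "('k::field \<Rightarrow> 'a::ab_group_add \<Rightarrow> 'a) \<Rightarrow> ('k, 'a) functional2 fps set"
  where "htensor2_space s = {T. \<forall>n. fps_nth T n \<in> tensor2_space s}"

definition htensor2 ::
  "('k::field \<Rightarrow> 'a::ab_group_add \<Rightarrow> 'a) \<Rightarrow> 'a fps \<Rightarrow> 'a fps \<Rightarrow> ('k, 'a) functional2 fps"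
  where "htensor2 s x y = Abs_fps (\<lambda>n. \<Sum>i\<le>n. tensor2 s (fps_nth x i) (fps_nth y (n - i)))"

definition coeff_map :: "('v::zero fps \<Rightarrow> 'w fps) \<Rightarrow> nat \<Rightarrow> 'v \<Rightarrow> 'w"
  where "coeff_map f i x = fps_nth (f (fps_const x)) i"

definition fps_extend :: "(nat \<Rightarrow> 'v \<Rightarrow> 'w::ab_group_add) \<Rightarrow> 'v fps \<Rightarrow> 'w fps"
  where "fps_extend u T = Abs_fps (\<lambda>n. \<Sum>i\<le>n. u i (fps_nth T (n - i)))"

definition htmap :: "('k::field \<Rightarrow> 'a::ab_group_add \<Rightarrow> 'a) \<Rightarrow> ('a fps \<Rightarrow> 'a fps) \<Rightarrow>
    ('a fps \<Rightarrow> 'a fps) \<Rightarrow> ('k, 'a) functional2 fps \<Rightarrow> ('k, 'a) functional2 fps"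
  where "htmap s f g =
    fps_extend (\<lambda>n F. \<Sum>i\<le>n. tmap s (coeff_map f i) (coeff_map g (n - i)) F)"

definition htmap_left :: "('k::field \<Rightarrow> 'a::ab_group_add \<Rightarrow> 'a) \<Rightarrow>
    ('a fps \<Rightarrow> ('k, 'a) functional2 fps) \<Rightarrow> ('k, 'a) functional2 fps \<Rightarrow> ('k, 'a) functional3 fps"
  where "htmap_left s D = fps_extend (\<lambda>n. tmap_left s (coeff_map D n))"

definition htmap_right :: "('k::field \<Rightarrow> 'a::ab_group_add \<Rightarrow> 'a) \<Rightarrow>
    ('a fps \<Rightarrow> ('k, 'a) functional2 fps) \<Rightarrow> ('k, 'a) functional2 fps \<Rightarrow> ('k, 'a) functional3 fps"
  where "htmap_right s D = fps_extend (\<lambda>n. tmap_right s (coeff_map D n))"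

definition hflip :: "('k::zero, 'a) functional2 fps \<Rightarrow> ('k, 'a) functional2 fps"
  where "hflip T = Abs_fps (\<lambda>n. flip (fps_nth T n))"

lemma module_fps_scale:
  assumes "vector_space s"
  shows "module (fps_scale s)"
proof -
  interpret vector_space s by fact
  show ?thesis
  proof
    fix a b :: "'a fps" and x y :: "'b fps"
    show "fps_scale s a (x + y) = fps_scale s a x + fps_scale s a y"
      by (simp add: fps_scale_def fps_eq_iff scale_right_distrib sum.distrib)
    show "fps_scale s (a + b) x = fps_scale s a x + fps_scale s b x"
      by (simp add: fps_scale_def fps_eq_iff scale_left_distrib sum.distrib)
    have "(\<Sum>i\<le>n. s (if i = 0 then 1 else 0) (fps_nth x (n - i))) = fps_nth x n" for n
      by (subst sum.remove[of _ 0]) auto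
    then show "fps_scale s 1 x = x"
      by (simp add: fps_scale_def fps_eq_iff)
    have "(\<Sum>i\<le>n. s (fps_nth a i) (\<Sum>j\<le>n - i. s (fps_nth b j) (fps_nth x (n - i - j)))) =
        (\<Sum>m\<le>n. s (\<Sum>i\<le>m. fps_nth a i * fps_nth b (m - i)) (fps_nth x (n - m)))" for n
    proof -
      have "(\<Sum>i\<le>n. s (fps_nth a i) (\<Sum>j\<le>n - i. s (fps_nth b j) (fps_nth x (n - i - j)))) =
          (\<Sum>(i, j)\<in>(SIGMA i:{..n}. {..n - i}).
            s (fps_nth a i * fps_nth b j) (fps_nth x (n - i - j)))"
        by (simp add: scale_sum_right sum.Sigma)
      also have "\<dots> = (\<Sum>(m, i)\<in>(SIGMA m:{..n}. {..m}).
            s (fps_nth a i * fps_nth b (m - i)) (fps_nth x (n - m)))"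
        by (rule sum.reindex_bij_witness
            [of _ "\<lambda>(m, i). (i, m - i)" "\<lambda>(i, j). (i + j, i)"]) auto
      also have "\<dots> = (\<Sum>m\<le>n. s (\<Sum>i\<le>m. fps_nth a i * fps_nth b (m - i)) (fps_nth x (n - m)))"
        by (simp add: scale_sum_left sum.Sigma)
      finally show ?thesis .
    qed
    then show "fps_scale s a (fps_scale s b x) = fps_scale s (a * b) x"
      by (simp add: fps_scale_def fps_eq_iff fps_mult_nth atLeast0AtMost)
  qed
qed

lemma fps_scale_X_power_nth:
  assumes "vector_space s"
  shows "fps_nth (fps_scale s (fps_X ^ j) f) n = (if n < j then 0 else fps_nth f (n - j))"
proof -
  interpret vector_space s by fact
  have "(\<Sum>i\<le>n. s (if i = j then 1 else 0) (fps_nth f (n - i))) =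
      (\<Sum>i\<le>n. if i = j then fps_nth f (n - i) else 0)"
    by (intro sum.cong) auto
  then show ?thesis by (simp add: fps_scale_def fps_X_power_nth)
qed

lemma hcong_iff:
  assumes "vector_space s"
  shows "hcong s n f g \<longleftrightarrow> (\<forall>i<n. fps_nth f i = fps_nth g i)"
proof
  assume "hcong s n f g"
  then obtain q where q: "f - g = fps_scale s (fps_X ^ n) q" by (auto simp: hcong_def)
  have "fps_nth (f - g) i = 0" if "i < n" for i
    unfolding q fps_scale_X_power_nth[OF assms] using that by simp
  then show "\<forall>i<n. fps_nth f i = fps_nth g i" by simp
next
  assume "\<forall>i<n. fps_nth f i = fps_nth g i"
  then have "f - g = fps_scale s (fps_X ^ n) (fps_shift n (f - g))"
    by (auto simp: fps_eq_iff fps_scale_X_power_nth[OF assms])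
  then show "hcong s n f g" unfolding hcong_def by blast
qed

lemma fps_linear_eq_extend:
  assumes s: "vector_space s" and t: "vector_space t"
    and f: "module_hom (fps_scale s) (fps_scale t) f"
  shows "f = fps_extend (coeff_map f)"
proof (intro ext fps_ext)
  fix x n
  interpret f: module_hom "fps_scale s" "fps_scale t" f by fact
  have *: "x = (\<Sum>j\<le>n. fps_scale s (fps_X ^ j) (fps_const (fps_nth x j)))
      + fps_scale s (fps_X ^ Suc n) (fps_shift (Suc n) x)"
  proof (rule fps_ext)
    fix m
    have "(\<Sum>j\<le>n. if m < j then 0 else fps_nth (fps_const (fps_nth x j)) (m - j)) =
        (\<Sum>j\<le>n. if j = m then fps_nth x m else 0)"
      by (intro sum.cong) auto
    then show "fps_nth x m = fps_nth ((\<Sum>j\<le>n. fps_scale s (fps_X ^ j) (fps_const (fps_nth x j)))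
        + fps_scale s (fps_X ^ Suc n) (fps_shift (Suc n) x)) m"
      by (simp add: fps_sum_nth fps_scale_X_power_nth[OF s] del: power_Suc)
  qed
  have "fps_nth (f x) n = (\<Sum>j\<le>n. fps_nth (f (fps_const (fps_nth x j))) (n - j))"
    by (subst *) (simp add: f.add f.sum f.scale fps_sum_nth fps_scale_X_power_nth[OF t]
        del: power_Suc)
  also have "\<dots> = (\<Sum>i\<le>n. fps_nth (f (fps_const (fps_nth x (n - i)))) i)"
    by (rule sum.reindex_bij_witness[of _ "\<lambda>i. n - i" "\<lambda>i. n - i"]) auto
  finally show "fps_nth (f x) n = fps_nth (fps_extend (coeff_map f) x) n"
    by (simp add: fps_extend_def coeff_map_def)
qed

lemma fps_extend_linear:
  assumes s: "vector_space s" and t: "vector_space t" and u: "\<And>i. module_hom s t (u i)"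
  shows "module_hom (fps_scale s) (fps_scale t) (fps_extend u)"
proof -
  interpret t: vector_space t by fact
  have add: "u i (x + y) = u i x + u i y" and scale: "u i (s c x) = t c (u i x)" for i c x y
    using u[of i] by (auto simp: module_hom_def module_hom_axioms_def)
  have sum: "u i (\<Sum>j\<in>J. g j) = (\<Sum>j\<in>J. u i (g j))" for i J and g :: "nat \<Rightarrow> _"
    using u[of i] by (rule module_hom.sum)
  have "(\<Sum>i\<le>n. \<Sum>j\<le>n - i. t (fps_nth c j) (u i (fps_nth x (n - i - j)))) =
      (\<Sum>j\<le>n. \<Sum>i\<le>n - j. t (fps_nth c j) (u i (fps_nth x (n - j - i))))" for c x n
    by (simp add: sum.Sigma)
      (rule sum.reindex_bij_witness[of _ "\<lambda>(j, i). (i, j)" "\<lambda>(i, j). (j, i)"],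
        auto simp: diff_commute add.commute)
  then show ?thesis
    using module_fps_scale[OF s] module_fps_scale[OF t]
    by (auto simp: module_hom_def module_hom_axioms_def fps_extend_def fps_eq_iff fps_scale_def
        add scale sum sum.distrib t.scale_sum_right)
qed

lemma coeff_map_linear:
  assumes s: "vector_space s" and t: "vector_space t"
    and f: "module_hom (fps_scale s) (fps_scale t) f"
  shows "module_hom s t (coeff_map f i)"
proof -
  interpret s: vector_space s by fact
  interpret t: vector_space t by fact
  interpret f: module_hom "fps_scale s" "fps_scale t" f by fact
  have [simp]: "fps_scale s (fps_const c) (fps_const x) = fps_const (s c x)" for c x
    by (auto simp: fps_scale_def fps_eq_iff intro!: sum.neutral)
  have [simp]: "fps_nth (fps_scale t (fps_const c) y) n = t c (fps_nth y n)" for c y n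
  proof -
    have "(\<Sum>i\<le>n. t (if i = 0 then c else 0) (fps_nth y (n - i))) = t c (fps_nth y n)"
      by (subst sum.remove[of _ 0]) auto
    then show ?thesis by (simp add: fps_scale_def)
  qed
  show ?thesis
  proof
    show "coeff_map f i (x + y) = coeff_map f i x + coeff_map f i y" for x y
      by (simp add: coeff_map_def f.add flip: fps_const_add)
    show "coeff_map f i (s c x) = t c (coeff_map f i x)" for c x
      using f.scale[of "fps_const c" "fps_const x"] by (simp add: coeff_map_def)
  qed
qed


lemma module_hom_nth_sum:
  assumes "vector_space s" "vector_space t" "module_hom (fps_scale s) (fps_scale t) f"
  shows "fps_nth (f x) n = (\<Sum>i\<le>n. coeff_map f i (fps_nth x (n - i)))"
  by (subst fps_linear_eq_extend[OF assms]) (simp add: fps_extend_def)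

text \<open>\<open>f \<otimes> g\<close> is the \<open>k[[h]]\<close>-linear map with \<open>x \<otimes> y \<mapsto> f x \<otimes> g y\<close>.\<close>

lemma htmap_linear:
  "module_hom (fps_scale fun_scale) (fps_scale fun_scale) (htmap s f g)"
  "module_hom (fps_scale fun_scale) (fps_scale fun_scale) (htmap_left s D)"
  "module_hom (fps_scale fun_scale) (fps_scale fun_scale) (htmap_right s D)"
proof -
  have "Vector_Spaces.linear fun_scale fun_scale (\<lambda>F. \<Sum>i\<in>I. tmap s (p i) (q i) F)"
    for p q and I :: "nat set"
  proof (rule fun_scale_linearI)
    show "(\<Sum>i\<in>I. tmap s (p i) (q i) (\<lambda>\<phi>. F \<phi> + G \<phi>)) \<phi> =
        (\<Sum>i\<in>I. tmap s (p i) (q i) F) \<phi> + (\<Sum>i\<in>I. tmap s (p i) (q i) G) \<phi>" for F G \<phi>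
      by (cases "bilinear_map s (*) \<phi>") (simp_all add: sum_fun_app tmap_def sum.distrib)
    show "(\<Sum>i\<in>I. tmap s (p i) (q i) (\<lambda>\<phi>. c * F \<phi>)) \<phi> =
        c * (\<Sum>i\<in>I. tmap s (p i) (q i) F) \<phi>" for c F \<phi>
      by (cases "bilinear_map s (*) \<phi>") (simp_all add: sum_fun_app tmap_def sum_distrib_left)
  qed
  note linear_module_hom[OF this]
  then show "module_hom (fps_scale fun_scale) (fps_scale fun_scale) (htmap s f g)"
    unfolding htmap_def by (intro fps_extend_linear vector_space_fun_scale)
  show "module_hom (fps_scale fun_scale) (fps_scale fun_scale) (htmap_left s D)"
    "module_hom (fps_scale fun_scale) (fps_scale fun_scale) (htmap_right s D)"
    unfolding htmap_left_def htmap_right_def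
    by (intro fps_extend_linear vector_space_fun_scale linear_module_hom linear_tensor_maps)+
qed

lemma htmap_htensor2:
  assumes s: "vector_space s" and f: "module_hom (fps_scale s) (fps_scale s) f"
    and g: "module_hom (fps_scale s) (fps_scale s) g"
  shows "htmap s f g (htensor2 s x y) = htensor2 s (f x) (g y)"
proof (rule fps_ext)
  fix n
  let ?f = "coeff_map f" and ?g = "coeff_map g"
  let ?T = "\<lambda>i j k l. tensor2 s (?f i (fps_nth x k)) (?g j (fps_nth y l))"
  have bil: "bilinear_map s fun_scale (tensor2 s)"
    using tensor2_universal(1)[OF s s] .
  have sum1: "tensor2 s (\<Sum>i\<in>I. a i) b = (\<Sum>i\<in>I. tensor2 s (a i) b)" for I :: "nat set" and a b
    by (rule module_hom.sum[of s fun_scale "\<lambda>a. tensor2 s a b"])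
      (use bil in \<open>simp add: bilinear_map_def\<close>)
  have sum2: "tensor2 s b (\<Sum>i\<in>I. a i) = (\<Sum>i\<in>I. tensor2 s b (a i))" for I :: "nat set" and a b
    by (rule module_hom.sum[of s fun_scale]) (use bil in \<open>simp add: bilinear_map_def\<close>)
  have tm: "tmap s p q (\<Sum>i\<in>I. F i) = (\<Sum>i\<in>I. tmap s p q (F i))" for p q and I :: "nat set" and F
    by (rule module_hom.sum[OF linear_module_hom[OF linear_tensor_maps(1)]])
  note lin = coeff_map_linear[OF s s f] coeff_map_linear[OF s s g]
  have "fps_nth (htmap s f g (htensor2 s x y)) n =
      (\<Sum>m\<le>n. \<Sum>i\<le>m. \<Sum>k\<le>n - m. ?T i (m - i) k (n - m - k))"
    by (simp add: htmap_def fps_extend_def htensor2_def tm tmap_tensor2[OF lin])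
  also have "\<dots> = (\<Sum>(m, i, k)\<in>(SIGMA m:{..n}. {..m} \<times> {..n - m}). ?T i (m - i) k (n - m - k))"
    by (simp add: sum.Sigma sum.cartesian_product)
  also have "\<dots> = (\<Sum>(m, i, j)\<in>(SIGMA m:{..n}. {..m} \<times> {..n - m}). ?T i j (m - i) (n - m - j))"
    by (rule sum.reindex_bij_witness
        [of _ "\<lambda>(m, i, j). (i + j, i, m - i)" "\<lambda>(m, i, k). (i + k, i, m - i)"]) (auto simp: add.commute)
  also have "\<dots> = (\<Sum>m\<le>n. \<Sum>i\<le>m. \<Sum>j\<le>n - m. ?T i j (m - i) (n - m - j))"
    by (simp add: sum.Sigma sum.cartesian_product)
  also have "\<dots> = fps_nth (htensor2 s (f x) (g y)) n"
    by (simp add: htensor2_def module_hom_nth_sum[OF s s f] module_hom_nth_sum[OF s s g] sum1 sum2)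
      (intro sum.cong refl sum.swap)
  finally show "fps_nth (htmap s f g (htensor2 s x y)) n = fps_nth (htensor2 s (f x) (g y)) n" .
qed

lemma hflip_htensor2:
  fixes s :: "'k::field \<Rightarrow> 'a::ab_group_add \<Rightarrow> 'a"
  shows "hflip (htensor2 s x y) = htensor2 s y x"
proof (rule fps_ext)
  fix n
  have "flip (\<Sum>i\<in>I. F i) = (\<Sum>i\<in>I. flip (F i))"
    for I :: "nat set" and F :: "nat \<Rightarrow> ('k, 'a) functional2"
    by (rule module_hom.sum[OF linear_module_hom[OF linear_tensor_maps(4)]])
  then have "fps_nth (hflip (htensor2 s x y)) n =
      (\<Sum>i\<le>n. tensor2 s (fps_nth y (n - i)) (fps_nth x i))"
    by (simp add: hflip_def htensor2_def flip_tensors)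
  also have "\<dots> = fps_nth (htensor2 s y x) n"
    unfolding htensor2_def fps_nth_Abs_fps
    by (rule sum.reindex_bij_witness[of _ "\<lambda>i. n - i" "\<lambda>i. n - i"]) auto
  finally show "fps_nth (hflip (htensor2 s x y)) n = fps_nth (htensor2 s y x) n" .
qed

section \<open>Deformations and quasiclassical limits\<close>

text \<open>
  Topologically free structures, on the module \<open>A[[h]]\<close> for the vector space \<open>A\<close> with scalar
  multiplication \<open>s\<close>.
\<close>

locale topologically_free_assoc_algebra = vector_space s
  for s :: "'k::field_char_0 \<Rightarrow> 'a::ab_group_add \<Rightarrow> 'a" +
  fixes mulh :: "'a fps \<Rightarrow> 'a fps \<Rightarrow> 'a fps"
  assumes mulh_bilinear: "bilinear_map (fps_scale s) (fps_scale s) mulh"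
    and mulh_assoc: "mulh (mulh x y) z = mulh x (mulh y z)"

locale topologically_free_coassoc_coalgebra = vector_space s
  for s :: "'k::field_char_0 \<Rightarrow> 'a::ab_group_add \<Rightarrow> 'a" +
  fixes Deltah :: "'a fps \<Rightarrow> ('k, 'a) functional2 fps"
  assumes Deltah_linear: "module_hom (fps_scale s) (fps_scale fun_scale) Deltah"
    and Deltah_space: "Deltah x \<in> htensor2_space s"
    and coassoch: "htmap_left s Deltah (Deltah x) = htmap_right s Deltah (Deltah x)"

locale topologically_free_asi_bialgebra =
  topologically_free_assoc_algebra s mulh + topologically_free_coassoc_coalgebra s Deltah
  for s :: "'k::field_char_0 \<Rightarrow> 'a::ab_group_add \<Rightarrow> 'a" and mulh Deltah +
  assumes Deltah_mulh: "Deltah (mulh x y) =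
      htmap s id (Lm mulh x) (Deltah y) + htmap s (Rm mulh y) id (Deltah x)"
    and antisymmetryh:
      "(htmap s (Lm mulh y) id (Deltah x) - htmap s id (Rm mulh y) (Deltah x))
       + hflip (htmap s (Lm mulh x) id (Deltah y) - htmap s id (Rm mulh x) (Deltah y)) = 0"

locale asi_bialgebra_deformation =
  asi_bialgebra s mul Delta + topologically_free_asi_bialgebra s mulh Deltah
  for s :: "'k::field_char_0 \<Rightarrow> 'a::ab_group_add \<Rightarrow> 'a" and mul Delta mulh Deltah +
  assumes mulh_cong: "hcong s 1 (mulh (fps_const x) (fps_const y)) (fps_const (mul x y))"
    and Deltah_cong: "hcong fun_scale 1 (Deltah (fps_const x)) (fps_const (Delta x))"

text \<open>
  Division by \<open>h\<close> is \<^term>\<open>fps_shift 1\<close>: the series divided here are divisible by \<open>h\<close> when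
  \<open>mul\<close> is commutative and \<open>Delta\<close> is cocommutative.
\<close>

definition is_QCL ::
  "('k::field_char_0 \<Rightarrow> 'a::ab_group_add \<Rightarrow> 'a) \<Rightarrow> ('a fps \<Rightarrow> 'a fps \<Rightarrow> 'a fps) \<Rightarrow>
   ('a fps \<Rightarrow> ('k, 'a) functional2 fps) \<Rightarrow> ('a \<Rightarrow> 'a \<Rightarrow> 'a) \<Rightarrow> ('a \<Rightarrow> ('k, 'a) functional2) \<Rightarrow> bool"
  where "is_QCL s mulh Deltah br delta \<longleftrightarrow>
    (\<forall>x y. hcong s 1 (fps_const (br x y))
      (fps_shift 1 (mulh (fps_const x) (fps_const y) - mulh (fps_const y) (fps_const x)))) \<and>
    (\<forall>x. hcong fun_scale 1 (fps_const (delta x))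
      (fps_shift 1 (Deltah (fps_const x) - hflip (Deltah (fps_const x)))))"

lemma is_QCL_divisible:
  fixes s :: "'k::field_char_0 \<Rightarrow> 'a::ab_group_add \<Rightarrow> 'a"
  assumes "comm_cocomm_asi_bialgebra s mul Delta" "asi_bialgebra_deformation s mul Delta mulh Deltah"
  defines "c x y \<equiv> mulh (fps_const x) (fps_const y) - mulh (fps_const y) (fps_const x)"
    and "d x \<equiv> Deltah (fps_const x) - hflip (Deltah (fps_const x))"
  shows "c x y = fps_scale s fps_X (fps_shift 1 (c x y))"
    and "d x = fps_scale fun_scale fps_X (fps_shift 1 (d x))"
    and "\<exists>!(br, delta). is_QCL s mulh Deltah br delta"
proof -
  interpret comm_cocomm_asi_bialgebra s mul Delta by fact
  interpret asi_bialgebra_deformation s mul Delta mulh Deltah by fact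
  have s: "vector_space s" ..
  have "fps_nth (mulh (fps_const x) (fps_const y)) 0 = mul x y" for x y
    using mulh_cong unfolding hcong_iff[OF s] by simp
  then have "fps_nth (c x y) 0 = 0" by (simp add: c_def mul_commute)
  then show "c x y = fps_scale s fps_X (fps_shift 1 (c x y))"
    using fps_scale_X_power_nth[OF s, of 1] by (auto simp: fps_eq_iff)
  have "fps_nth (Deltah (fps_const x)) 0 = Delta x"
    using Deltah_cong unfolding hcong_iff[OF vector_space_fun_scale] by simp
  then have "fps_nth (d x) 0 = 0" by (simp add: d_def hflip_def flip: cocommute)
  then show "d x = fps_scale fun_scale fps_X (fps_shift 1 (d x))"
    by (auto simp: fps_eq_iff fps_scale_X_power_nth[OF vector_space_fun_scale, of 1, simplified])
  show "\<exists>!(br, delta). is_QCL s mulh Deltah br delta"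
  proof (rule ex1I)
    show "case (\<lambda>x y. fps_nth (c x y) 1, \<lambda>x. fps_nth (d x) 1) of
        (br, delta) \<Rightarrow> is_QCL s mulh Deltah br delta"
      by (simp add: is_QCL_def hcong_iff[OF s] hcong_iff[OF vector_space_fun_scale] c_def d_def)
  next
    fix p
    assume p: "case p of (br, delta) \<Rightarrow> is_QCL s mulh Deltah br delta"
    obtain br delta where p': "p = (br, delta)" by fastforce
    have "br x y = fps_nth (c x y) 1" and "delta x = fps_nth (d x) 1" for x y
      using p unfolding p' is_QCL_def hcong_iff[OF s] hcong_iff[OF vector_space_fun_scale] c_def d_def
      by simp_all
    then show "p = (\<lambda>x y. fps_nth (c x y) 1, \<lambda>x. fps_nth (d x) 1)"
      unfolding p' prod.inject by blast
  qed
qed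

end

theory Submission
  imports Defs
begin

text \<open>
  The proof separates algebra from order counting.  On \<open>A[[h]]\<close> let \<open>[x, y]\<^sub>h = x \<circ>\<^sub>h y - y \<circ>\<^sub>h x\<close> and
  \<open>\<delta>\<^sub>h = \<Delta>\<^sub>h - \<sigma> \<Delta>\<^sub>h\<close>.  These operations satisfy, exactly and not only modulo a power of \<open>h\<close>,
  noncommutative forms of all the identities of a Poisson bialgebra.  The commutator of an
  associative product is a Lie bracket of derivations (\<open>brh_jacobi\<close>, \<open>brh_leibniz\<close>), and
  dually the cocommutator of a coassociative coproduct satisfies the co-Jacobi and co-Leibniz
  identities (\<open>deltah_co_jacobi\<close>, \<open>deltah_co_leibniz\<close>).  For the mixed identities, the formula for
  \<open>\<Delta>\<^sub>h(x \<circ>\<^sub>h y)\<close> is not symmetric in its two factors; the antisymmetry axiom of an ASI bialgebra is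
  exactly the difference between what it gives for \<open>\<Delta>\<^sub>h [x, y]\<^sub>h\<close> and \<open>\<delta>\<^sub>h (x \<circ>\<^sub>h y)\<close> and the desired
  expressions (\<open>Deltah_brh\<close>, \<open>deltah_mulh\<close>).  Antisymmetrising \<open>\<Delta>\<^sub>h [x, y]\<^sub>h\<close> then gives the cocycle
  condition of a Lie bialgebra (\<open>deltah_brh\<close>).

  Since \<open>\<circ>\<close> is commutative and \<open>\<Delta>\<close> is cocommutative, \<open>[x, y]\<^sub>h\<close> and \<open>\<delta>\<^sub>h(x)\<close> are divisible by \<open>h\<close> for
  constant \<open>x\<close> and \<open>y\<close>, and the quasiclassical limit consists of their coefficients at \<open>h\<close>.  An identity in
  which every term contains \<open>k\<close> of these operations is therefore divisible by \<open>h\<^sup>k\<close>, and its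
  coefficient at \<open>h\<^sup>k\<close> involves only \<open>{,}\<close>, \<open>\<delta>\<close>, \<open>\<circ>\<close> and \<open>\<Delta>\<close>.  Here \<open>k = 1\<close> for the Leibniz type
  identities and \<open>k = 2\<close> for the Jacobi, co-Jacobi and cocycle identities.
\<close>

section \<open>Tensors as linear functionals on bilinear forms\<close>

text \<open>
  A tensor is determined by its values on bilinear forms, so most identities between maps of tensors
  are checked by evaluation.  Additivity needs bilinear arguments, because pure tensors are set to
  \<open>0\<close> elsewhere.
\<close>

lemma tensor2_space_diff:
  assumes "F \<in> tensor2_space s" "bilinear_map s (*) \<phi>" "bilinear_map s (*) \<chi>"
  shows "F (\<lambda>x y. \<phi> x y - \<chi> x y) = F \<phi> - F \<chi>"
proof -
  interpret F: vector_space "fun_scale :: 'k::field \<Rightarrow> ('p \<Rightarrow> 'k) \<Rightarrow> 'p \<Rightarrow> 'k"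
    by (rule vector_space_fun_scale)
  have "bilinear_map s (*) (\<lambda>x y. \<phi> x y - \<chi> x y)"
    using assms(2,3)
    by (auto simp: bilinear_map_def module_hom_def module_hom_axioms_def algebra_simps)
  with assms(2,3) have t: "tensor2 s a b (\<lambda>x y. \<phi> x y - \<chi> x y) = tensor2 s a b \<phi> - tensor2 s a b \<chi>"
    for a b by (simp add: tensor2_def)
  from assms(1)[unfolded tensor2_space_def] show ?thesis
    by (induction rule: F.span_induct_alt) (auto simp: fun_scale_def t algebra_simps)
qed

lemma tensor2_space_zero:
  assumes "vector_space s" "F \<in> tensor2_space s"
  shows "F (\<lambda>x y. 0) = 0"
proof -
  have "module s" "module ((*) :: 'a \<Rightarrow> 'a \<Rightarrow> 'a)"
    using assms(1) vector_space_times by (simp_all add: module_iff_vector_space)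
  then have "bilinear_map s (*) (\<lambda>x y. 0)"
    by (auto simp: bilinear_map_def module_hom_def module_hom_axioms_def)
  from tensor2_space_diff[OF assms(2) this this] show ?thesis by simp
qed

lemma flip_in_tensor2_space:
  fixes s :: "'k::field \<Rightarrow> 'a::ab_group_add \<Rightarrow> 'a"
  assumes "F \<in> tensor2_space s"
  shows "flip F \<in> tensor2_space s"
proof -
  interpret F: vector_space "fun_scale :: 'k::field \<Rightarrow> ('p \<Rightarrow> 'k) \<Rightarrow> 'p \<Rightarrow> 'k"
    by (rule vector_space_fun_scale)
  interpret fl: Vector_Spaces.linear fun_scale fun_scale "flip :: ('k, 'a) functional2 \<Rightarrow> _"
    by (rule linear_tensor_maps)
  from assms[unfolded tensor2_space_def] show ?thesis
    unfolding tensor2_space_def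
  proof (induction rule: F.span_induct_alt)
    case base
    show ?case by (subst fl.zero) (rule F.span_zero)
  next
    case (step c x y)
    then obtain a b where "x = tensor2 s a b" by auto
    then have "flip x = tensor2 s b a" by (simp only: flip_tensors)
    then have "flip x \<in> {tensor2 s x y | x y. True}" by blast
    then show ?case
      unfolding fl.add fl.scale by (rule F.span_add[OF F.span_scale[OF F.span_base] step(2)])
  qed
qed

lemma diff_in_tensor2_space:
  "F \<in> tensor2_space s \<Longrightarrow> G \<in> tensor2_space s \<Longrightarrow> F - G \<in> tensor2_space s"
  unfolding tensor2_space_def
  by (rule module.span_diff[OF vector_space_fun_scale[folded module_iff_vector_space]])

lemma flip_simps:
  shows "flip (flip F) = F"
    and "flip (F + G) = flip F + flip G"
    and "flip (F - G) = flip F - flip G"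
  by (auto simp: flip_def fun_eq_iff)

lemma bilinear_map_swap: "bilinear_map s t (\<lambda>x y. \<phi> y x) \<longleftrightarrow> bilinear_map s t \<phi>"
  by (auto simp: bilinear_map_def)

lemma flip_tmap: "flip (tmap s f g F) = tmap s g f (flip F)"
proof
  fix \<phi>
  show "flip (tmap s f g F) \<phi> = tmap s g f (flip F) \<phi>"
    using bilinear_map_swap[of s "(*)" \<phi>] by (simp add: flip_def tmap_def)
qed

lemma tmap_diff_left:
  assumes F: "F \<in> tensor2_space s"
    and f: "module_hom s s f" "module_hom s s f'" and g: "module_hom s s g"
  shows "tmap s (\<lambda>x. f x - f' x) g F = tmap s f g F - tmap s f' g F"
proof
  fix \<phi>
  show "tmap s (\<lambda>x. f x - f' x) g F \<phi> = (tmap s f g F - tmap s f' g F) \<phi>"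
  proof (cases "bilinear_map s (*) \<phi>")
    case True
    have b: "bilinear_map s (*) (\<lambda>x y. \<phi> (p x) (g y))" if "module_hom s s p" for p
      unfolding bilinear_map_def
      using True module_hom_comp[OF g, of "(*)"] module_hom_comp[OF that, of "(*)"]
      by (auto simp: bilinear_map_def)
    have "\<phi> (x - y) z = \<phi> x z - \<phi> y z" for x y z
      using True module_hom.diff[of s "(*)" "\<lambda>x. \<phi> x z"] by (auto simp: bilinear_map_def)
    then show ?thesis
      using True tensor2_space_diff[OF F b[OF f(1)] b[OF f(2)]] by (simp add: tmap_def)
  qed (simp add: tmap_def)
qed

lemma tmap_zero_left:
  assumes s: "vector_space s" and F: "F \<in> tensor2_space s"
  shows "tmap s (\<lambda>x. 0) g F = 0"
proof
  fix \<phi>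
  have "\<phi> 0 z = 0" if "bilinear_map s (*) \<phi>" for z
    using that module_hom.zero[of s "(*)" "\<lambda>x. \<phi> x z"] by (auto simp: bilinear_map_def)
  then show "tmap s (\<lambda>x. 0) g F \<phi> = 0 \<phi>"
    using tensor2_space_zero[OF s F] by (simp add: tmap_def)
qed

text \<open>The second tensor factor is reduced to the first by conjugating with \<open>\<sigma>\<close>.\<close>

lemma tmap_zero_right:
  assumes s: "vector_space s" and F: "F \<in> tensor2_space s"
  shows "tmap s f (\<lambda>x. 0) F = 0"
proof -
  have "flip (tmap s f (\<lambda>x. 0) F) = 0"
    unfolding flip_tmap using s F by (intro tmap_zero_left flip_in_tensor2_space)
  then have "flip (flip (tmap s f (\<lambda>x. 0) F)) = flip 0" by simp
  then show ?thesis by (simp add: flip_simps(1)) (simp add: flip_def fun_eq_iff)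
qed

lemma tensor_maps_zero:
  "tmap s f g 0 = 0" "tmap_right s D 0 = 0"
  by (simp_all add: tmap_def tmap_right_def fun_eq_iff)

text \<open>\<open>flip_right\<close> is \<open>id \<otimes> \<sigma>\<close>.\<close>

definition flip_right :: "('k, 'a) functional3 \<Rightarrow> ('k, 'a) functional3"
  where "flip_right F = (\<lambda>\<psi>. F (\<lambda>x y z. \<psi> x z y))"

lemma trilinear_map_permute:
  shows "trilinear_map s t (\<lambda>x y z. \<psi> x z y) \<longleftrightarrow> trilinear_map s t \<psi>"
    and "trilinear_map s t (\<lambda>x y z. \<psi> z x y) \<longleftrightarrow> trilinear_map s t \<psi>"
  by (auto simp: trilinear_map_def)

text \<open>
  \<open>(id \<otimes> D) \<sigma>\<close> sends \<open>x \<otimes> y\<close> to \<open>y \<otimes> D x\<close>, which is \<open>D x \<otimes> y\<close> with its last factor moved to the front.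
  This is how coassociativity, which relates \<open>D \<otimes> id\<close> and \<open>id \<otimes> D\<close>, enters after an application of \<open>\<sigma>\<close>.
\<close>

lemma tmap_right_flip: "tmap_right s D (flip F) = rotate3 (tmap_left s D F)"
proof
  fix \<psi>
  show "tmap_right s D (flip F) \<psi> = rotate3 (tmap_left s D F) \<psi>"
    using trilinear_map_permute(2)[of s "(*)" \<psi>]
    by (simp add: tmap_right_def tmap_left_def flip_def rotate3_def)
qed

text \<open>
  \<open>id \<otimes> (D - \<sigma> D) = (1 - id \<otimes> \<sigma>) (id \<otimes> D)\<close>.  The linearity of \<open>D\<close> and the membership of its values in
  the tensor square make \<open>x, y \<mapsto> (D y) (\<psi> x)\<close> a bilinear form, on which \<open>F\<close> is additive.
\<close>

lemma tmap_right_cocommutator: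
  assumes s: "vector_space s" and F: "F \<in> tensor2_space s"
    and D: "module_hom s fun_scale D" and R: "\<And>x. D x \<in> tensor2_space s"
  shows "tmap_right s (\<lambda>x. D x - flip (D x)) F = tmap_right s D F - flip_right (tmap_right s D F)"
proof
  fix \<psi>
  have ms: "module s" "module ((*) :: 'a \<Rightarrow> 'a \<Rightarrow> 'a)"
    using s vector_space_times by (simp_all add: module_iff_vector_space)
  have D': "module_hom s (*) (\<lambda>x. D x \<phi>)" for \<phi>
    using D ms by (auto simp: module_hom_def module_hom_axioms_def fun_scale_def)
  have b: "bilinear_map s (*) (\<lambda>x y. D y (\<lambda>u v. \<psi> x u v))"
    if \<psi>: "trilinear_map s (*) \<psi>" for \<psi>
    unfolding bilinear_map_def
  proof (intro conjI allI D')
    show "module_hom s (*) (\<lambda>x. D y (\<lambda>u v. \<psi> x u v))" for y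
      by (rule module_hom_span_eval[OF s _ _ R, where \<psi> = "\<lambda>u v x. \<psi> x u v"])
        (use \<psi> in \<open>simp_all add: trilinear_map_def bilinear_map_def\<close>)
  qed
  note perm = trilinear_map_permute(1)[of s "(*)" \<psi>]
  show "tmap_right s (\<lambda>x. D x - flip (D x)) F \<psi> =
      (tmap_right s D F - flip_right (tmap_right s D F)) \<psi>"
  proof (cases "trilinear_map s (*) \<psi>")
    case True
    then show ?thesis
      using tensor2_space_diff[OF F b[of \<psi>] b[of "\<lambda>x y z. \<psi> x z y"]]
      by (simp add: tmap_right_def flip_right_def flip_def perm)
  qed (simp add: tmap_right_def flip_right_def perm)
qed

lemma tmap_left_cocommutator:
  fixes s :: "'k::field \<Rightarrow> 'a::ab_group_add \<Rightarrow> 'a"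
  assumes s: "vector_space s" and F: "F \<in> tensor2_space s"
    and D: "module_hom s fun_scale D" and R: "\<And>x. D x \<in> tensor2_space s"
  shows "tmap_left s (\<lambda>x. D x - flip (D x)) F = tmap_left s D F - flip_left (tmap_left s D F)"
proof -
  have rot: "rotate3 (rotate3 (rotate3 G)) = G" for G :: "('k, 'a) functional3"
    by (simp add: rotate3_def)
  have left: "tmap_left s E F = rotate3 (rotate3 (tmap_right s E (flip F)))" for E
    by (simp add: tmap_right_flip rot)
  show ?thesis
    unfolding left tmap_right_cocommutator[OF s flip_in_tensor2_space[OF F] D R]
    by (simp add: rotate3_def flip_left_def flip_right_def fun_eq_iff)
qed

lemma tmap_left_right_zero_map:
  assumes s: "vector_space s" and F: "F \<in> tensor2_space s"
  shows "tmap_left s (\<lambda>x. 0) F = 0" "tmap_right s (\<lambda>x. 0) F = 0"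
  using tensor2_space_zero[OF s F] by (auto simp: tmap_left_def tmap_right_def fun_eq_iff)

section \<open>Coefficients of linear maps between modules of power series\<close>

lemma module_hom_diff:
  assumes "module_hom s t f" "module_hom s t g"
  shows "module_hom s t (\<lambda>x. f x - g x)"
proof -
  interpret f: module_hom s t f by fact
  interpret g: module_hom s t g by fact
  show ?thesis
    by unfold_locales (simp_all add: f.add g.add f.scale g.scale f.m2.scale_right_diff_distrib)
qed

text \<open>
  The order counting rests on the product formula \<open>(f x)\<^sub>n = \<Sum> f\<^sub>i x\<^sub>j\<close> over \<open>i + j = n\<close>.  A
  single term is left at order 1 if \<open>f\<^sub>0 = 0\<close> or \<open>x\<^sub>0 = 0\<close>, and at order 2 if both vanish.
\<close>

lemma module_hom_nth_1:
  assumes "vector_space s" "vector_space t" "module_hom (fps_scale s) (fps_scale t) f"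
  shows "fps_nth (f x) 1 = coeff_map f 0 (fps_nth x 1) + coeff_map f 1 (fps_nth x 0)"
  by (simp add: module_hom_nth_sum[OF assms])

lemma module_hom_nth_2:
  assumes "vector_space s" "vector_space t" "module_hom (fps_scale s) (fps_scale t) f"
    and "fps_nth x 0 = 0"
  shows "fps_nth (f x) 2 = coeff_map f 0 (fps_nth x 2) + coeff_map f 1 (fps_nth x 1)"
  using module_hom.zero[OF coeff_map_linear[OF assms(1-3)], of 2] assms(4)
  by (simp add: module_hom_nth_sum[OF assms(1-3)] numeral_2_eq_2)

lemma hflip_simps:
  fixes F G :: "('k::field, 'a) functional2 fps"
  shows "hflip (hflip F) = F"
    and "hflip (F + G) = hflip F + hflip G"
    and "hflip (F - G) = hflip F - hflip G"
  by (auto simp: hflip_def fps_eq_iff flip_simps)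

lemma hflip_linear:
  "module_hom (fps_scale fun_scale) (fps_scale fun_scale)
    (hflip :: ('k::field, 'a) functional2 fps \<Rightarrow> _)"
proof -
  \<comment> \<open>\<open>\<sigma>\<close> has no higher coefficients: it is the extension of a map of \<open>A \<otimes> A\<close> itself.\<close>
  define u :: "nat \<Rightarrow> ('k, 'a) functional2 \<Rightarrow> ('k, 'a) functional2"
    where "u i F = (if i = 0 then flip F else 0)" for i F
  have "fps_nth (hflip F) n = fps_nth (fps_extend u F) n" for F :: "('k, 'a) functional2 fps" and n
    by (simp add: hflip_def fps_extend_def u_def sum.remove[of _ 0])
  then have *: "hflip = fps_extend u" by (intro ext fps_ext) simp
  have "module_hom fun_scale fun_scale (u i)" for i
    by (rule linear_module_hom, rule fun_scale_linearI) (auto simp: flip_def u_def)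
  from fps_extend_linear[OF vector_space_fun_scale vector_space_fun_scale this]
  show ?thesis unfolding * .
qed

lemma flip_sum: "flip (\<Sum>i\<in>I. F i) = (\<Sum>i\<in>I. flip (F i))"
  by (auto simp: flip_def sum_fun_app fun_eq_iff)

lemma hflip_htmap: "hflip (htmap s f g F) = htmap s g f (hflip F)"
proof (rule fps_ext)
  fix n
  have "(\<Sum>i\<le>m. tmap s (coeff_map g (m - i)) (coeff_map f i) G) =
    (\<Sum>i\<le>m. tmap s (coeff_map g i) (coeff_map f (m - i)) G)" for m G
    by (rule sum.reindex_bij_witness[of _ "\<lambda>i. m - i" "\<lambda>i. m - i"]) auto
  then show "fps_nth (hflip (htmap s f g F)) n = fps_nth (htmap s g f (hflip F)) n"
    by (simp add: hflip_def htmap_def fps_extend_def flip_sum flip_tmap)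
qed

lemma htmap_diff_left:
  assumes s: "vector_space s" and F: "F \<in> htensor2_space s"
    and f: "module_hom (fps_scale s) (fps_scale s) f" "module_hom (fps_scale s) (fps_scale s) f'"
    and g: "module_hom (fps_scale s) (fps_scale s) g"
  shows "htmap s (\<lambda>x. f x - f' x) g F = htmap s f g F - htmap s f' g F"
proof (rule fps_ext)
  fix n
  have c: "coeff_map (\<lambda>x. f x - f' x) i = (\<lambda>x. coeff_map f i x - coeff_map f' i x)" for i
    by (auto simp: coeff_map_def)
  note lin = coeff_map_linear[OF s s]
  have F': "fps_nth F i \<in> tensor2_space s" for i
    using F by (simp add: htensor2_space_def)
  show "fps_nth (htmap s (\<lambda>x. f x - f' x) g F) n = fps_nth (htmap s f g F - htmap s f' g F) n"
    by (simp add: htmap_def fps_extend_def c tmap_diff_left[OF F' lin lin lin] f g sum_subtractf)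
qed

lemma htmap_diff_right:
  assumes s: "vector_space s" and F: "F \<in> htensor2_space s"
    and f: "module_hom (fps_scale s) (fps_scale s) f" "module_hom (fps_scale s) (fps_scale s) f'"
    and g: "module_hom (fps_scale s) (fps_scale s) g"
  shows "htmap s g (\<lambda>x. f x - f' x) F = htmap s g f F - htmap s g f' F"
proof -
  have "hflip F \<in> htensor2_space s"
    using F by (simp add: htensor2_space_def hflip_def flip_in_tensor2_space)
  from htmap_diff_left[OF s this f g]
  have "hflip (hflip (htmap s g (\<lambda>x. f x - f' x) F)) =
      hflip (hflip (htmap s g f F) - hflip (htmap s g f' F))"
    by (simp add: hflip_htmap)
  then show ?thesis by (simp add: hflip_simps)
qed

lemma coeff_map_id: "coeff_map id i = (if i = 0 then id else (\<lambda>x. 0))"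
  by (auto simp: coeff_map_def)

text \<open>
  The coefficient of \<open>f \<otimes> id\<close> at \<open>h\<^sup>n\<close> is a sum over \<open>f\<^sub>i \<otimes> id\<^sub>j\<close>, and only \<open>id\<^sub>0\<close> is nonzero.
\<close>

lemma htmap_id_nth:
  assumes s: "vector_space s" and F: "F \<in> htensor2_space s"
  shows "fps_nth (htmap s f id F) n = (\<Sum>i\<le>n. tmap s (coeff_map f i) id (fps_nth F (n - i)))"
    and "fps_nth (htmap s id f F) n = (\<Sum>i\<le>n. tmap s id (coeff_map f i) (fps_nth F (n - i)))"
proof -
  have F': "fps_nth F i \<in> tensor2_space s" for i
    using F by (simp add: htensor2_space_def)
  have "(\<Sum>j\<le>i. tmap s (coeff_map f j) (coeff_map id (i - j)) (fps_nth F m)) =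
      tmap s (coeff_map f i) id (fps_nth F m)" for i m
    by (subst sum.remove[of _ i])
      (auto simp: coeff_map_id tmap_zero_right[OF s F'] intro!: sum.neutral)
  then show "fps_nth (htmap s f id F) n = (\<Sum>i\<le>n. tmap s (coeff_map f i) id (fps_nth F (n - i)))"
    by (simp add: htmap_def fps_extend_def)
  have "(\<Sum>j\<le>i. tmap s (coeff_map id j) (coeff_map f (i - j)) (fps_nth F m)) =
      tmap s id (coeff_map f i) (fps_nth F m)" for i m
    by (subst sum.remove[of _ 0])
      (auto simp: coeff_map_id tmap_zero_left[OF s F'] intro!: sum.neutral)
  then show "fps_nth (htmap s id f F) n = (\<Sum>i\<le>n. tmap s id (coeff_map f i) (fps_nth F (n - i)))"
    by (simp add: htmap_def fps_extend_def)
qed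

lemma htmap_id_nth_1:
  assumes s: "vector_space s" and F: "F \<in> htensor2_space s"
  shows "fps_nth (htmap s f id F) 1 =
      tmap s (coeff_map f 0) id (fps_nth F 1) + tmap s (coeff_map f 1) id (fps_nth F 0)"
    and "fps_nth (htmap s id f F) 1 =
      tmap s id (coeff_map f 0) (fps_nth F 1) + tmap s id (coeff_map f 1) (fps_nth F 0)"
  by (simp_all add: htmap_id_nth[OF assms])

lemma htmap_id_nth_2:
  assumes s: "vector_space s" and F: "F \<in> htensor2_space s"
  shows "fps_nth (htmap s f id F) 2 = tmap s (coeff_map f 0) id (fps_nth F 2)
      + tmap s (coeff_map f 1) id (fps_nth F 1) + tmap s (coeff_map f 2) id (fps_nth F 0)"
    and "fps_nth (htmap s id f F) 2 = tmap s id (coeff_map f 0) (fps_nth F 2)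
      + tmap s id (coeff_map f 1) (fps_nth F 1) + tmap s id (coeff_map f 2) (fps_nth F 0)"
  by (simp_all add: htmap_id_nth[OF assms] numeral_2_eq_2)

section \<open>Commutator and cocommutator of an associative deformation\<close>

definition commutator :: "('v::ab_group_add \<Rightarrow> 'v \<Rightarrow> 'v) \<Rightarrow> 'v \<Rightarrow> 'v \<Rightarrow> 'v"
  where "commutator m x y = m x y - m y x"

definition hcocommutator ::
  "('a fps \<Rightarrow> ('k::field, 'a) functional2 fps) \<Rightarrow> 'a fps \<Rightarrow> ('k, 'a) functional2 fps"
  where "hcocommutator D x = D x - hflip (D x)"

lemma hcocommutator_skew: "hflip (hcocommutator D x) = - hcocommutator D x"
  by (simp add: hcocommutator_def hflip_simps)

context topologically_free_assoc_algebra
begin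

abbreviation brh where "brh \<equiv> commutator mulh"

lemma mulh_linear:
  "module_hom (fps_scale s) (fps_scale s) (\<lambda>y. mulh x y)"
  "module_hom (fps_scale s) (fps_scale s) (\<lambda>y. mulh y x)"
  using mulh_bilinear by (auto simp: bilinear_map_def)

lemma brh_linear:
  "module_hom (fps_scale s) (fps_scale s) (\<lambda>y. brh x y)"
  "module_hom (fps_scale s) (fps_scale s) (\<lambda>y. brh y x)"
  unfolding commutator_def
  by (rule module_hom_diff[OF mulh_linear(1) mulh_linear(2)],
      rule module_hom_diff[OF mulh_linear(2) mulh_linear(1)])

lemmas mulh_diff = mulh_linear[THEN module_hom.diff]

lemma brh_jacobi: "brh x (brh y z) + brh y (brh z x) + brh z (brh x y) = 0"
  by (simp add: commutator_def mulh_diff mulh_assoc)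

lemma brh_leibniz: "brh x (mulh y z) = mulh (brh x y) z + mulh y (brh x z)"
  by (simp add: commutator_def mulh_diff mulh_assoc)

end

context topologically_free_coassoc_coalgebra
begin

abbreviation deltah where "deltah \<equiv> hcocommutator Deltah"

lemma deltah_linear: "module_hom (fps_scale s) (fps_scale fun_scale) deltah"
  unfolding hcocommutator_def[abs_def]
  by (rule module_hom_diff[OF Deltah_linear module_hom_comp[OF Deltah_linear hflip_linear]])

lemma deltah_space: "deltah x \<in> htensor2_space s"
  using Deltah_space[of x]
  by (simp add: htensor2_space_def hcocommutator_def hflip_def flip_in_tensor2_space
      diff_in_tensor2_space)

lemma coeff_map_deltah:
  "coeff_map deltah i = (\<lambda>x. coeff_map Deltah i x - flip (coeff_map Deltah i x))"
  by (auto simp: coeff_map_def hcocommutator_def hflip_def)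

lemma coeff_Deltah:
  "module_hom s fun_scale (coeff_map Deltah i)" "coeff_map Deltah i x \<in> tensor2_space s"
  using coeff_map_linear[OF _ vector_space_fun_scale Deltah_linear, of i] Deltah_space
  by (auto simp: coeff_map_def htensor2_space_def vector_space_axioms)

lemma htmap_right_deltah:
  assumes "F \<in> htensor2_space s"
  shows "fps_nth (htmap_right s deltah F) n =
    fps_nth (htmap_right s Deltah F) n - flip_right (fps_nth (htmap_right s Deltah F) n)"
proof -
  have F: "fps_nth F i \<in> tensor2_space s" for i
    using assms by (simp add: htensor2_space_def)
  have "flip_right (\<Sum>i\<in>I. G i) = (\<Sum>i\<in>I. flip_right (G i))"
    for I :: "nat set" and G :: "nat \<Rightarrow> ('k, 'a) functional3"
    by (auto simp: flip_right_def sum_fun_app fun_eq_iff)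
  then show ?thesis
    by (simp add: htmap_right_def fps_extend_def coeff_map_deltah sum_subtractf
        tmap_right_cocommutator[OF vector_space_axioms F coeff_Deltah])
qed

lemma htmap_left_deltah:
  assumes "F \<in> htensor2_space s"
  shows "fps_nth (htmap_left s deltah F) n =
    fps_nth (htmap_left s Deltah F) n - flip_left (fps_nth (htmap_left s Deltah F) n)"
proof -
  have F: "fps_nth F i \<in> tensor2_space s" for i
    using assms by (simp add: htensor2_space_def)
  have "flip_left (\<Sum>i\<in>I. G i) = (\<Sum>i\<in>I. flip_left (G i))"
    for I :: "nat set" and G :: "nat \<Rightarrow> ('k, 'a) functional3"
    by (auto simp: flip_left_def sum_fun_app fun_eq_iff)
  then show ?thesis
    by (simp add: htmap_left_def fps_extend_def coeff_map_deltah sum_subtractf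
        tmap_left_cocommutator[OF vector_space_axioms F coeff_Deltah])
qed

text \<open>
  With \<open>T = (id \<otimes> \<Delta>\<^sub>h) \<Delta>\<^sub>h\<close> and the rotation \<open>\<tau>\<close>, coassociativity gives
  \<open>(id \<otimes> \<Delta>\<^sub>h) \<sigma> \<Delta>\<^sub>h = \<tau> (\<Delta>\<^sub>h \<otimes> id) \<Delta>\<^sub>h = \<tau> T\<close>.
\<close>

lemma htmap_right_Deltah_deltah:
  "fps_nth (htmap_right s Deltah (deltah x)) n =
    fps_nth (htmap_right s Deltah (Deltah x)) n - rotate3 (fps_nth (htmap_right s Deltah (Deltah x)) n)"
proof -
  have rot: "rotate3 (\<Sum>i\<in>I. G i) = (\<Sum>i\<in>I. rotate3 (G i))"
    for I :: "nat set" and G :: "nat \<Rightarrow> ('k, 'a) functional3"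
    by (auto simp: rotate3_def sum_fun_app fun_eq_iff)
  have "fps_nth (htmap_right s Deltah (hflip (Deltah x))) n =
      rotate3 (fps_nth (htmap_left s Deltah (Deltah x)) n)"
    by (simp add: htmap_right_def htmap_left_def fps_extend_def hflip_def tmap_right_flip rot)
  then show ?thesis
    unfolding hcocommutator_def module_hom.diff[OF htmap_linear(3)] by (simp add: coassoch)
qed

text \<open>
  The previous lemmas express \<open>(id \<otimes> \<delta>\<^sub>h) \<delta>\<^sub>h\<close> as \<open>(1 - \<rho>) (1 - \<tau>) T\<close> with \<open>\<rho> = id \<otimes> \<sigma>\<close>.  The rotation
  satisfies \<open>\<tau>\<^sup>3 = 1\<close> and \<open>\<rho> \<tau> = \<tau>\<^sup>2 \<rho>\<close>, so the cyclic sum \<open>1 + \<tau> + \<tau>\<^sup>2\<close> annihilates both \<open>(1 - \<tau>) T\<close> and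
  \<open>\<rho> (1 - \<tau>) T = (1 - \<tau>\<^sup>2) \<rho> T\<close>.
\<close>

lemma deltah_co_jacobi:
  fixes x n
  defines "F \<equiv> fps_nth (htmap_right s deltah (deltah x)) n"
  shows "F + rotate3 F + rotate3 (rotate3 F) = 0"
  unfolding F_def htmap_right_deltah[OF deltah_space] htmap_right_Deltah_deltah
  by (simp add: rotate3_def flip_right_def fun_eq_iff)

text \<open>
  Both sides equal \<open>T - \<tau> T\<close>: on the right, \<open>\<sigma> \<otimes> id\<close> occurs with opposite signs in
  the two terms, and \<open>(\<sigma> \<otimes> id) (id \<otimes> \<sigma>) = \<tau>\<close>.
\<close>

lemma deltah_co_leibniz:
  "fps_nth (htmap_right s Deltah (deltah x)) n =
    fps_nth (htmap_left s deltah (Deltah x)) n + flip_left (fps_nth (htmap_right s deltah (Deltah x)) n)"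
  unfolding htmap_right_deltah[OF Deltah_space] htmap_left_deltah[OF Deltah_space]
    htmap_right_Deltah_deltah coassoch
  by (simp add: rotate3_def flip_right_def flip_left_def fun_eq_iff)

end

context topologically_free_asi_bialgebra
begin

lemma htmap_brh:
  assumes "F \<in> htensor2_space s"
  shows "htmap s (Lm brh x) id F = htmap s (Lm mulh x) id F - htmap s (Rm mulh x) id F"
    and "htmap s id (Lm brh x) F = htmap s id (Lm mulh x) F - htmap s id (Rm mulh x) F"
proof -
  have "module_hom (fps_scale s) (fps_scale s) id"
    using module_fps_scale[OF vector_space_axioms]
    by (simp add: module_hom_def module_hom_axioms_def)
  note * = mulh_linear[of x] this
  show "htmap s (Lm brh x) id F = htmap s (Lm mulh x) id F - htmap s (Rm mulh x) id F"
    using htmap_diff_left[OF vector_space_axioms assms *]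
    by (simp add: Lm_def Rm_def commutator_def)
  show "htmap s id (Lm brh x) F = htmap s id (Lm mulh x) F - htmap s id (Rm mulh x) F"
    using htmap_diff_right[OF vector_space_axioms assms *]
    by (simp add: Lm_def Rm_def commutator_def)
qed

lemma hflip_Deltah_space: "hflip (Deltah x) \<in> htensor2_space s"
  using Deltah_space[of x] by (simp add: htensor2_space_def hflip_def flip_in_tensor2_space)

lemmas htmap_diff = module_hom.diff[OF htmap_linear(1)]

text \<open>
  With \<open>\<sigma>\<close> moved onto \<open>\<Delta>\<^sub>h(x)\<close>, the antisymmetry axiom takes the shape of the defects in
  \<open>Deltah_brh\<close> and \<open>deltah_mulh\<close> below.
\<close>

lemma antisymmetryh_expanded:
  "htmap s (Lm mulh x) id (Deltah y) - htmap s id (Rm mulh x) (Deltah y)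
    + (htmap s id (Lm mulh y) (hflip (Deltah x)) - htmap s (Rm mulh y) id (hflip (Deltah x))) = 0"
  using antisymmetryh[of x y] by (simp add: hflip_simps hflip_htmap)

text \<open>
  Expanding \<open>\<Delta>\<^sub>h(x \<circ>\<^sub>h y) - \<Delta>\<^sub>h(y \<circ>\<^sub>h x)\<close> gives the right-hand side up to the left-hand side of the
  antisymmetry axiom.  Left and right multiplications by \<open>y\<close> must be kept apart here: they agree
  only modulo \<open>h\<close>.
\<close>

lemma Deltah_brh:
  "Deltah (brh x y) = htmap s (Lm brh x) id (Deltah y) + htmap s id (Lm brh x) (Deltah y)
    + (htmap s (Rm mulh y) id (deltah x) - htmap s id (Lm mulh y) (deltah x))" (is "_ = ?rhs")
proof -
  have "Deltah (brh x y) = Deltah (mulh x y) - Deltah (mulh y x)"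
    by (simp add: commutator_def module_hom.diff[OF Deltah_linear])
  then have "?rhs - Deltah (brh x y) =
      htmap s (Lm mulh x) id (Deltah y) - htmap s id (Rm mulh x) (Deltah y)
      + (htmap s id (Lm mulh y) (hflip (Deltah x)) - htmap s (Rm mulh y) id (hflip (Deltah x)))"
    by (simp add: Deltah_mulh htmap_brh Deltah_space hcocommutator_def htmap_diff algebra_simps)
  then show ?thesis unfolding antisymmetryh_expanded by simp
qed

text \<open>
  The defect is the same instance of the antisymmetry axiom as in \<open>Deltah_brh\<close>.  The last summand
  involves \<open>\<sigma> \<Delta>\<^sub>h\<close> where the classical identity has \<open>\<Delta>\<close>; cocommutativity removes the difference
  modulo \<open>h\<close>.
\<close>

lemma deltah_mulh:
  "deltah (mulh x y) = htmap s (Rm mulh y) id (deltah x) + htmap s (Lm mulh x) id (deltah y)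
    + htmap s id (Lm brh x) (Deltah y) + htmap s id (Lm brh y) (hflip (Deltah x))" (is "_ = ?rhs")
proof -
  have "?rhs - deltah (mulh x y) =
      htmap s (Lm mulh x) id (Deltah y) - htmap s id (Rm mulh x) (Deltah y)
      + (htmap s id (Lm mulh y) (hflip (Deltah x)) - htmap s (Rm mulh y) id (hflip (Deltah x)))"
    by (simp add: hcocommutator_def Deltah_mulh hflip_simps hflip_htmap htmap_diff htmap_brh
        Deltah_space hflip_Deltah_space algebra_simps)
  then show ?thesis unfolding antisymmetryh_expanded by simp
qed

text \<open>
  Apply \<open>1 - \<sigma>\<close> to \<open>Deltah_brh\<close>.  As \<open>\<sigma> \<delta>\<^sub>h = - \<delta>\<^sub>h\<close>, the multiplications by \<open>y\<close> combine to \<open>- ad(y)\<close> in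
  both tensor factors of \<open>\<delta>\<^sub>h(x)\<close>.
\<close>

lemma deltah_brh:
  "deltah (brh x y) = (htmap s (Lm brh x) id (deltah y) + htmap s id (Lm brh x) (deltah y))
    - (htmap s (Lm brh y) id (deltah x) + htmap s id (Lm brh y) (deltah x))"
  by (simp add: hcocommutator_def Deltah_brh hflip_simps hflip_htmap htmap_diff htmap_brh
      Deltah_space hflip_Deltah_space algebra_simps)

end

section \<open>The quasiclassical limit\<close>

locale quasiclassical_limit =
  comm_cocomm_asi_bialgebra s mul Delta + asi_bialgebra_deformation s mul Delta mulh Deltah
  for s :: "'k::field_char_0 \<Rightarrow> 'a::ab_group_add \<Rightarrow> 'a" and mul Delta mulh Deltah +
  fixes br :: "'a \<Rightarrow> 'a \<Rightarrow> 'a" and delta :: "'a \<Rightarrow> ('k, 'a) functional2"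
  assumes QCL: "is_QCL s mulh Deltah br delta"
begin

lemma mulh_nth_0: "fps_nth (mulh (fps_const x) (fps_const y)) 0 = mul x y"
  using mulh_cong by (simp add: hcong_iff[OF vector_space_axioms])

lemma Deltah_nth_0: "fps_nth (Deltah (fps_const x)) 0 = Delta x"
  using Deltah_cong by (simp add: hcong_iff[OF vector_space_fun_scale])

lemma brh_nth:
  "fps_nth (brh (fps_const x) (fps_const y)) 0 = 0"
  "fps_nth (brh (fps_const x) (fps_const y)) 1 = br x y"
  using QCL
  by (simp_all add: is_QCL_def hcong_iff[OF vector_space_axioms] commutator_def mulh_nth_0
      mul_commute[of y x])

lemma deltah_nth:
  "fps_nth (deltah (fps_const x)) 0 = 0"
  "fps_nth (deltah (fps_const x)) 1 = delta x"
  using QCL cocommute[of x]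
  by (simp_all add: is_QCL_def hcong_iff[OF vector_space_fun_scale] hcocommutator_def Deltah_nth_0
      hflip_def)

text \<open>
  Commutativity of \<open>\<circ>\<close> identifies left and right multiplications at order 0 and makes \<open>[x, \<cdot>]\<^sub>h\<close> vanish
  there; cocommutativity of \<open>\<Delta>\<close> does the same for \<open>\<delta>\<^sub>h\<close>.  No higher coefficients of the deformed
  operations contribute to the limit.
\<close>

lemma coeff_maps:
  "coeff_map (Lm mulh (fps_const x)) 0 = Lm mul x"
  "coeff_map (Rm mulh (fps_const x)) 0 = Lm mul x"
  "coeff_map (Lm brh (fps_const x)) 0 = (\<lambda>y. 0)"
  "coeff_map (Lm brh (fps_const x)) 1 = Lm br x"
  "coeff_map Deltah 0 = Delta"
  "coeff_map deltah 0 = (\<lambda>y. 0)"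
  "coeff_map deltah 1 = delta"
  by (auto simp: coeff_map_def Lm_def Rm_def mulh_nth_0 mul_commute brh_nth deltah_nth Deltah_nth_0
      simp del: One_nat_def)

lemma nth_in_tensor2_space:
  "fps_nth (Deltah x) n \<in> tensor2_space s" "fps_nth (deltah x) n \<in> tensor2_space s"
  using Deltah_space deltah_space by (auto simp: htensor2_space_def)

lemma br_linear: "module_hom s s (\<lambda>y. br x y)" "module_hom s s (\<lambda>y. br y x)"
proof -
  note lin = coeff_map_linear[OF vector_space_axioms vector_space_axioms, of _ 1]
  show "module_hom s s (\<lambda>y. br x y)"
    using lin[OF brh_linear(1)[of "fps_const x"]] unfolding coeff_map_def brh_nth .
  show "module_hom s s (\<lambda>y. br y x)"
    using lin[OF brh_linear(2)[of "fps_const x"]] unfolding coeff_map_def brh_nth .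
qed

lemma delta_linear: "Vector_Spaces.linear s fun_scale delta"
  using coeff_map_linear[OF vector_space_axioms vector_space_fun_scale deltah_linear, of 1]
  unfolding coeff_maps
  by (simp add: linear_iff_module_hom vector_space_axioms vector_space_fun_scale)

lemma delta_space: "delta x \<in> tensor2_space s"
  using nth_in_tensor2_space(2)[of "fps_const x" 1] unfolding deltah_nth .

lemma delta_skew: "delta x = - flip (delta x)"
proof -
  have "flip (delta x) = fps_nth (hflip (deltah (fps_const x))) 1"
    by (simp add: hflip_def deltah_nth del: One_nat_def)
  also have "\<dots> = - delta x"
    unfolding hcocommutator_skew fps_neg_nth deltah_nth ..
  finally show ?thesis by simp
qed

text \<open>
  In \<open>A[[h]]\<close> the operations are nested, so one argument is a nonconstant series \<open>z\<close>.  At the lowest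
  possible order it enters only through its lowest coefficient: the higher coefficients of the
  operations meet \<open>z\<^sub>0 = 0\<close>, and the higher coefficients of \<open>z\<close> meet a vanishing \<open>[x, \<cdot>]\<^sub>0\<close> or \<open>\<delta>\<^sub>0\<close>.
\<close>

lemma brh_nth_1: "fps_nth (brh (fps_const x) z) 1 = br x (fps_nth z 0)"
  using module_hom_nth_1[OF vector_space_axioms vector_space_axioms brh_linear(1), of "fps_const x" z]
    coeff_maps(3,4)[of x]
  by (simp add: Lm_def del: One_nat_def)

lemma brh_nth_2: "fps_nth z 0 = 0 \<Longrightarrow> fps_nth (brh (fps_const x) z) 2 = br x (fps_nth z 1)"
  using module_hom_nth_2[OF vector_space_axioms vector_space_axioms brh_linear(1), of z "fps_const x"]
    coeff_maps(3,4)[of x]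
  by (simp add: Lm_def del: One_nat_def)

lemma mulh_nth_1:
  assumes "fps_nth z 0 = 0"
  shows "fps_nth (mulh (fps_const x) z) 1 = mul x (fps_nth z 1)"
    and "fps_nth (mulh z (fps_const x)) 1 = mul (fps_nth z 1) x"
proof -
  note vs = vector_space_axioms vector_space_axioms
  show "fps_nth (mulh (fps_const x) z) 1 = mul x (fps_nth z 1)"
    using module_hom_nth_1[OF vs mulh_linear(1), of "fps_const x" z] assms
      module_hom.zero[OF coeff_map_linear[OF vs mulh_linear(1)], of "fps_const x" 1]
    by (simp add: coeff_map_def mulh_nth_0)
  show "fps_nth (mulh z (fps_const x)) 1 = mul (fps_nth z 1) x"
    using module_hom_nth_1[OF vs mulh_linear(2), of z "fps_const x"] assms
      module_hom.zero[OF coeff_map_linear[OF vs mulh_linear(2)], of "fps_const x" 1]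
    by (simp add: coeff_map_def mulh_nth_0)
qed

lemma deltah_nth_1: "fps_nth (deltah z) 1 = delta (fps_nth z 0)"
  using module_hom_nth_1[OF vector_space_axioms vector_space_fun_scale deltah_linear, of z]
  unfolding coeff_maps by simp

lemma deltah_nth_2: "fps_nth z 0 = 0 \<Longrightarrow> fps_nth (deltah z) 2 = delta (fps_nth z 1)"
  using module_hom_nth_2[OF vector_space_axioms vector_space_fun_scale deltah_linear, of z]
  unfolding coeff_maps by simp

lemma Deltah_nth_1: "fps_nth z 0 = 0 \<Longrightarrow> fps_nth (Deltah z) 1 = Delta (fps_nth z 1)"
  using module_hom_nth_1[OF vector_space_axioms vector_space_fun_scale Deltah_linear, of z]
    module_hom.zero[OF coeff_Deltah(1), of 1]
  unfolding coeff_maps by simp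

text \<open>The Poisson bialgebra identities are the coefficients at \<open>h\<close> or \<open>h\<^sup>2\<close> of the exact ones.\<close>

lemma br_jacobi: "br x (br y z) + br y (br z x) + br z (br x y) = 0"
  using arg_cong[OF brh_jacobi[of "fps_const x" "fps_const y" "fps_const z"], of "\<lambda>F. fps_nth F 2"]
  by (simp add: brh_nth_2 brh_nth del: One_nat_def)

lemma br_leibniz: "br x (mul y z) = mul (br x y) z + mul y (br x z)"
  using arg_cong[OF brh_leibniz[of "fps_const x" "fps_const y" "fps_const z"], of "\<lambda>F. fps_nth F 1"]
  by (simp add: brh_nth_1 mulh_nth_1 mulh_nth_0 brh_nth del: One_nat_def)

lemma delta_co_jacobi: "tmap_right s delta (delta x) + rotate3 (tmap_right s delta (delta x))
    + rotate3 (rotate3 (tmap_right s delta (delta x))) = 0"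
proof -
  have "fps_nth (htmap_right s deltah (deltah (fps_const x))) 2 = tmap_right s delta (delta x)"
    using tmap_left_right_zero_map(2)[OF vector_space_axioms nth_in_tensor2_space(2)]
    by (simp add: htmap_right_def fps_extend_def numeral_2_eq_2 deltah_nth[simplified]
        coeff_maps[simplified] tensor_maps_zero)
  then show ?thesis using deltah_co_jacobi[of "fps_const x" 2] by simp
qed

lemma delta_co_leibniz: "tmap_right s Delta (delta x) =
    tmap_left s delta (Delta x) + flip_left (tmap_right s delta (Delta x))"
proof -
  note zero = tmap_left_right_zero_map[OF vector_space_axioms nth_in_tensor2_space(1)]
  have "fps_nth (htmap_right s Deltah (deltah (fps_const x))) 1 = tmap_right s Delta (delta x)"
    by (simp add: htmap_right_def fps_extend_def deltah_nth[simplified]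
        coeff_maps[simplified] tensor_maps_zero)
  moreover have "fps_nth (htmap_right s deltah (Deltah (fps_const x))) 1 = tmap_right s delta (Delta x)"
    "fps_nth (htmap_left s deltah (Deltah (fps_const x))) 1 = tmap_left s delta (Delta x)"
    by (simp_all add: htmap_right_def htmap_left_def fps_extend_def Deltah_nth_0
        coeff_maps[simplified] zero)
  ultimately show ?thesis using deltah_co_leibniz[of "fps_const x" 1] by simp
qed

lemma hflip_Deltah_nth_0: "fps_nth (hflip (Deltah (fps_const x))) 0 = Delta x"
  using cocommute[of x] by (simp add: hflip_def Deltah_nth_0)

lemmas nth_htmap =
  htmap_id_nth_1[OF vector_space_axioms Deltah_space] htmap_id_nth_1[OF vector_space_axioms deltah_space]
  htmap_id_nth_1[OF vector_space_axioms hflip_Deltah_space]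
  htmap_id_nth_2[OF vector_space_axioms deltah_space]

lemma delta_of_mul: "delta (mul x y) =
    tmap s (Lm mul y) id (delta x) + tmap s (Lm mul x) id (delta y)
    + tmap s id (Lm br x) (Delta y) + tmap s id (Lm br y) (Delta x)"
proof -
  have "fps_nth (hflip (Deltah (fps_const x))) 1 \<in> tensor2_space s"
    using hflip_Deltah_space by (simp add: htensor2_space_def)
  note zero = tmap_zero_right[OF vector_space_axioms nth_in_tensor2_space(1)]
    tmap_zero_right[OF vector_space_axioms this]
  show ?thesis
    using arg_cong[OF deltah_mulh[of "fps_const x" "fps_const y"], of "\<lambda>F. fps_nth F 1"]
    by (simp add: deltah_nth_1 deltah_nth mulh_nth_0 nth_htmap coeff_maps tensor_maps_zero
        Deltah_nth_0 hflip_Deltah_nth_0 zero del: One_nat_def)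
qed

lemma Delta_of_br: "Delta (br x y) =
    (tmap s (Lm br x) id (Delta y) + tmap s id (Lm br x) (Delta y))
    + (tmap s (Lm mul y) id (delta x) - tmap s id (Lm mul y) (delta x))"
proof -
  note zero = tmap_zero_right[OF vector_space_axioms nth_in_tensor2_space(1)]
    tmap_zero_left[OF vector_space_axioms nth_in_tensor2_space(1)]
  show ?thesis
    using arg_cong[OF Deltah_brh[of "fps_const x" "fps_const y"], of "\<lambda>F. fps_nth F 1"]
    by (simp add: Deltah_nth_1 deltah_nth brh_nth nth_htmap coeff_maps tensor_maps_zero
        Deltah_nth_0 zero del: One_nat_def)
qed

lemma delta_of_br: "delta (br x y) =
    (tmap s (Lm br x) id (delta y) + tmap s id (Lm br x) (delta y))
    - (tmap s (Lm br y) id (delta x) + tmap s id (Lm br y) (delta x))"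
proof -
  note zero = tmap_zero_right[OF vector_space_axioms nth_in_tensor2_space(2)]
    tmap_zero_left[OF vector_space_axioms nth_in_tensor2_space(2)]
  show ?thesis
    using arg_cong[OF deltah_brh[of "fps_const x" "fps_const y"], of "\<lambda>F. fps_nth F 2"]
    by (simp add: deltah_nth_2 deltah_nth brh_nth nth_htmap coeff_maps tensor_maps_zero
        zero del: One_nat_def)
qed

lemma br_self: "br x x = 0"
  using brh_nth(2)[of x x] by (simp add: commutator_def)

lemma poisson_bialgebra: "poisson_bialgebra s br mul delta Delta"
proof -
  have "bilinear_map s s br"
    by (simp add: bilinear_map_def br_linear)
  then have lie: "lie_algebra s br"
    by (intro lie_algebra.intro lie_algebra_axioms.intro vector_space_axioms br_self br_jacobi)
  have colie: "lie_coalgebra s delta"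
    by (intro lie_coalgebra.intro lie_coalgebra_axioms.intro vector_space_axioms
        delta_linear delta_space delta_skew delta_co_jacobi)
  have "poisson_algebra s br mul"
    by (intro poisson_algebra.intro poisson_algebra_axioms.intro lie assoc_algebra_axioms
        mul_commute br_leibniz)
  moreover have "lie_bialgebra s br delta"
    by (intro lie_bialgebra.intro lie_bialgebra_axioms.intro lie colie delta_of_br)
  moreover have "poisson_coalgebra s delta Delta"
    by (intro poisson_coalgebra.intro poisson_coalgebra_axioms.intro colie coassoc_coalgebra_axioms
        cocommute delta_co_leibniz)
  ultimately show ?thesis
    by (intro poisson_bialgebra.intro poisson_bialgebra_axioms.intro
        comm_cocomm_asi_bialgebra_axioms delta_of_mul Delta_of_br)
qed

end

theorem theorem2p10:
  fixes s :: "'k::field_char_0 \<Rightarrow> 'a::ab_group_add \<Rightarrow> 'a"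
    and mul br :: "'a \<Rightarrow> 'a \<Rightarrow> 'a"
    and Delta delta :: "'a \<Rightarrow> ('k, 'a) functional2"
    and mulh :: "'a fps \<Rightarrow> 'a fps \<Rightarrow> 'a fps"
    and Deltah :: "'a fps \<Rightarrow> ('k, 'a) functional2 fps"
  assumes "comm_cocomm_asi_bialgebra s mul Delta"
    and "asi_bialgebra_deformation s mul Delta mulh Deltah"
    and "is_QCL s mulh Deltah br delta"
  shows "poisson_bialgebra s br mul delta Delta"
proof -
  interpret quasiclassical_limit s mul Delta mulh Deltah br delta
    using assms by (intro quasiclassical_limit.intro quasiclassical_limit_axioms.intro)
  show ?thesis by (rule poisson_bialgebra)
qed

end
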